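(* Let $0<\alpha<1$, $M>0$, $g,\delta,S\in\mathbb{R}$, and set $c_1=\frac\delta2-\frac{g^2}{9}$, $c_2=\frac{g\delta}{3}-\frac{2g^3}{27}$, $c_3=-\left(\frac\delta2-\frac{g^2}{9}\right)^2$. Let $0=t_0<t_1<\dots<t_N=T$ be a (possibly non-uniform) temporal grid, and let $(\phi^n)_{0\le n\le N}$, $(r^{n+\frac12})_{-1\le n\le N-1}$, with $r^{\frac12}=r^{-\frac12}=\frac12(\phi^0)^2-\frac g3\phi^0+c_1-S$, solve the $L1^+$-CN linear relaxation scheme for the time-fractional Swift-Hohenberg equation, that is, for all $0\le n\le N-1$, $$\partial_\tau^\alpha\phi^{n+\frac12}=-M\mu^{n+\frac12},$$ $$\mu^{n+\frac12}=(1+\Delta)^2\phi^{n+\frac12}+2\left(r^{n+\frac12}+S\right)\left(\phi^{n+\frac12}-\frac g3\right)+c_2,$$ $$\frac{r^{n+\frac12}+r^{n-\frac12}}{2}=\frac12(\phi^n)^2-\frac g3\phi^n+c_1-S .$$ Define $$E[\phi]=\int_\Omega\frac12\phi(1+\Delta)^2\phi+\frac14\phi^4-\frac g3\phi^3+\frac\delta2\phi^2\,d\mathbf{x},$$ $$\tilde E\left[\phi^{n+1},r^{n+\frac12}\right]=\int_\Omega\Big(\frac12\phi^{n+1}(1+\Delta)^2\phi^{n+1}+2\left(r^{n+\frac12}+S\right)\left(\frac12(\phi^{n+1})^2-\frac g3\phi^{n+1}+c_1-S\right)-\left(r^{n+\frac12}\right)^2+c_2\phi^{n+1}\Big)d\mathbf{x}+(c_3+S^2)|\Omega|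 ,$$ with $\tilde E[\phi^0,r^{-\frac12}]$ given by the same formula with $n=-1$. (i) For all $0\le n\le N-1$, $$\tilde E\left[\phi^{n+1},r^{n+\frac12}\right]\le\tilde E\left[\phi^0,r^{-\frac12}\right]=E[\phi^0].$$ (ii) Suppose moreover that the adjacent step ratios satisfy $\rho_{k+1}\ge H_{1-\alpha}(\rho_k)$ for all $k\ge2$ (with $k+1\le N$). Let $$\tilde E_\alpha\left[\phi^{n+1},r^{n+\frac12}\right]:=\tilde E\left[\phi^{n+1},r^{n+\frac12}\right]+\frac1M\mathcal A_{1-\alpha}\left(\nabla_\tau\phi^{n+1}\right).$$ Then for all $2\le n\le N-1$, $$\tilde E_\alpha\left[\phi^{n+1},r^{n+\frac12}\right]-\tilde E_\alpha\left[\phi^{n},r^{n-\frac12}\right]=-\frac1M\mathcal R_{1-\alpha}\left(\nabla_\tau\phi^{n+1}\right)\le0 .$$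
   Context: $\Omega$ is a bounded rectangular spatial domain with periodic boundary conditions; all functions $\phi^n,r^{n+\frac12},\mu^{n+\frac12}$ are real-valued, periodic and sufficiently smooth in space (the scheme is discrete in time only). $\langle\cdot,\cdot\rangle$ and $\|\cdot\|$ are the $L^2(\Omega)$ inner product and norm, and $|\Omega|$ is the measure of $\Omega$. Time steps: $\tau_k=t_k-t_{k-1}$ for $1\le k\le N$, adjacent step ratios $\rho_k=\tau_k/\tau_{k-1}$ for $2\le k\le N$. Notation: $\nabla_\tau u^k=u^k-u^{k-1}$ and $\phi^{n+\frac12}=\frac{\phi^{n+1}+\phi^n}{2}$. In contrast, $r^{n+\frac12}$ and $\mu^{n+\frac12}$ are unknowns attached to the half-level $n+\frac12$ (they are not averages). For $\beta\in(0,1)$ let $\omega_\beta(t)=t^{\beta-1}/\Gamma(\beta)$ and, for $1\le k\le n$, $$b^{(\beta,n)}_{n-k}=\frac{1}{\tau_n\tau_k}\int_{t_{n-1}}^{t_n}\int_{t_{k-1}}^{\min\{t_k,t\}}\omega_\beta(t-s)\,ds\,dt .$$ The $L1^+$ approximation of the Caputo derivative of order $\alpha$ is $\partial_\tau^\alpha\phi^{n+\frac12}=\sum_{k=1}^{n+1}b^{(1-\alpha,n+1)}_{n+1-k}\nabla_\tau\phi^k$. Modified kernels: $\tilde b^{(\beta,n)}_0=2b^{(\beta,n)}_0$ and $\tilde b^{(\beta,n)}_j=b^{(\beta,n)}_j$ for $1\le j\le n-1$. Step-ratio function: with $h_\beta(s)=(1+s)^{1+\beta}-s^{1+\beta}-1$,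 $$H_\beta(\rho)=\left[\frac{2h_\beta(\rho)-h_\beta(2\rho)}{\rho^{\beta}\,(4-2^{1+\beta})}\right]^{1/\beta}.$$ For a sequence $u^1,u^2,\dots$ of functions in $L^2(\Omega)$, define $$\mathcal A_\beta(u^n)=\frac12\sum_{k=1}^{n-1}\left(\tilde b^{(\beta,n)}_{n-k-1}-\tilde b^{(\beta,n)}_{n-k}\right)\Big\|\sum_{j=k+1}^n u^j\Big\|^2+\frac12\tilde b^{(\beta,n)}_{n-1}\Big\|\sum_{j=1}^n u^j\Big\|^2\quad(n\ge1),$$ $$\mathcal R_\beta(u^n)=\frac12\sum_{k=1}^{n-2}\left(\tilde b^{(\beta,n-1)}_{n-2-k}-\tilde b^{(\beta,n-1)}_{n-1-k}-\tilde b^{(\beta,n)}_{n-1-k}+\tilde b^{(\beta,n)}_{n-k}\right)\Big\|\sum_{j=k+1}^{n-1}u^j\Big\|^2+\frac12\left(\tilde b^{(\beta,n-1)}_{n-2}-\tilde b^{(\beta,n)}_{n-1}\right)\Big\|\sum_{j=1}^{n-1}u^j\Big\|^2\quad(n\ge2).$$ $\mathcal A_{1-\alpha}(\nabla_\tau\phi^{n+1})$ and $\mathcal R_{1-\alpha}(\nabla_\tau\phi^{n+1})$ denote these functionals with $\beta=1-\alpha$, index $n+1$ in place of $n$, and $u^j=\nabla_\tau\phi^j$. *)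

theory Defs
  imports "HOL-Analysis.Analysis"
begin

section \<open>Periodic functions and differential operators\<close>

definition box_periodic :: "'a::euclidean_space \<Rightarrow> 'a \<Rightarrow> ('a \<Rightarrow> real) \<Rightarrow> bool" where
  "box_periodic a b f \<longleftrightarrow> (\<forall>i\<in>Basis. \<forall>x. f (x + ((b - a) \<bullet> i) *\<^sub>R i) = f x)"

definition partial_deriv :: "'a::euclidean_space \<Rightarrow> ('a \<Rightarrow> real) \<Rightarrow> 'a \<Rightarrow> real" where
  "partial_deriv i f x = deriv (\<lambda>h. f (x + h *\<^sub>R i)) 0"

fun C_k :: "nat \<Rightarrow> ('a::euclidean_space \<Rightarrow> real) \<Rightarrow> bool" where
  "C_k 0 f \<longleftrightarrow> continuous_on UNIV f"
| "C_k (Suc k) f \<longleftrightarrow> continuous_on UNIV f \<and>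
     (\<forall>i\<in>Basis. (\<forall>x. (\<lambda>h. f (x + h *\<^sub>R i)) differentiable (at (0::real))) \<and>
                 C_k k (partial_deriv i f))"

definition laplacian :: "('a::euclidean_space \<Rightarrow> real) \<Rightarrow> 'a \<Rightarrow> real" where
  "laplacian f x = (\<Sum>i\<in>Basis. partial_deriv i (partial_deriv i f) x)"

definition one_plus_lap :: "('a::euclidean_space \<Rightarrow> real) \<Rightarrow> 'a \<Rightarrow> real" where
  "one_plus_lap f x = f x + laplacian f x"

definition SH_op :: "('a::euclidean_space \<Rightarrow> real) \<Rightarrow> 'a \<Rightarrow> real" where
  "SH_op f = one_plus_lap (one_plus_lap f)"

definition L2_inner :: "'a::euclidean_space set \<Rightarrow> ('a \<Rightarrow> real) \<Rightarrow> ('a \<Rightarrow> real) \<Rightarrow> real" where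
  "L2_inner \<Omega> u v = (LINT x:\<Omega>|lebesgue. u x * v x)"

definition L2_norm :: "'a::euclidean_space set \<Rightarrow> ('a \<Rightarrow> real) \<Rightarrow> real" where
  "L2_norm \<Omega> u = sqrt (L2_inner \<Omega> u u)"

section \<open>Time grid and convolution kernels\<close>

definition step :: "(nat \<Rightarrow> real) \<Rightarrow> nat \<Rightarrow> real" where
  "step t k = t k - t (k - 1)"

definition step_ratio :: "(nat \<Rightarrow> real) \<Rightarrow> nat \<Rightarrow> real" where
  "step_ratio t k = step t k / step t (k - 1)"

text \<open>Backward difference in the level index; only used for indices at least 1.\<close>

definition bdiff :: "(nat \<Rightarrow> 'a \<Rightarrow> real) \<Rightarrow> nat \<Rightarrow> 'a \<Rightarrow> real" where
  "bdiff u k x = u k x - u (k - 1) x"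

definition half_avg :: "(nat \<Rightarrow> 'a \<Rightarrow> real) \<Rightarrow> nat \<Rightarrow> 'a \<Rightarrow> real" where
  "half_avg u n x = (u (n + 1) x + u n x) / 2"

definition omega :: "real \<Rightarrow> real \<Rightarrow> real" where
  "omega \<beta> s = s powr (\<beta> - 1) / Gamma \<beta>"

text \<open>The arguments \<open>n\<close>, \<open>j\<close> stand for the upper index \<open>n\<close> and the lower index \<open>j = n - k\<close>
  with \<open>1 \<le> k \<le> n\<close>, so that \<open>k\<close> is recovered as \<open>n - j\<close>.\<close>

definition b_kernel :: "(nat \<Rightarrow> real) \<Rightarrow> real \<Rightarrow> nat \<Rightarrow> nat \<Rightarrow> real" where
  "b_kernel t \<beta> n j = (let k = n - j in
     1 / (step t n * step t k) *
     (LINT s:{t (n - 1)..t n}|lebesgue.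
        (LINT s':{t (k - 1)..min (t k) s}|lebesgue. omega \<beta> (s - s'))))"

definition b_tilde :: "(nat \<Rightarrow> real) \<Rightarrow> real \<Rightarrow> nat \<Rightarrow> nat \<Rightarrow> real" where
  "b_tilde t \<beta> n j = (if j = 0 then 2 * b_kernel t \<beta> n 0 else b_kernel t \<beta> n j)"

text \<open>\<open>L1plus t \<alpha> \<phi> n\<close> approximates the Caputo derivative at the half level \<open>n + 1/2\<close>.\<close>

definition L1plus :: "(nat \<Rightarrow> real) \<Rightarrow> real \<Rightarrow> (nat \<Rightarrow> 'a \<Rightarrow> real) \<Rightarrow> nat \<Rightarrow> 'a \<Rightarrow> real" where
  "L1plus t \<alpha> \<phi> n x = (\<Sum>k=1..n+1. b_kernel t (1 - \<alpha>) (n + 1) (n + 1 - k) * bdiff \<phi> k x)"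

definition h_fun :: "real \<Rightarrow> real \<Rightarrow> real" where
  "h_fun \<beta> s = (1 + s) powr (1 + \<beta>) - s powr (1 + \<beta>) - 1"

definition H_fun :: "real \<Rightarrow> real \<Rightarrow> real" where
  "H_fun \<beta> \<rho> =
     ((2 * h_fun \<beta> \<rho> - h_fun \<beta> (2 * \<rho>)) / (\<rho> powr \<beta> * (4 - 2 powr (1 + \<beta>)))) powr (1 / \<beta>)"

definition A_fun ::
  "'a::euclidean_space set \<Rightarrow> (nat \<Rightarrow> real) \<Rightarrow> real \<Rightarrow> (nat \<Rightarrow> 'a \<Rightarrow> real) \<Rightarrow> nat \<Rightarrow> real" where
  "A_fun \<Omega> t \<beta> u n =
     1/2 * (\<Sum>k=1..n-1. (b_tilde t \<beta> n (n - k - 1) - b_tilde t \<beta> n (n - k)) *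
                          (L2_norm \<Omega> (\<lambda>x. \<Sum>j=k+1..n. u j x))\<^sup>2)
   + 1/2 * b_tilde t \<beta> n (n - 1) * (L2_norm \<Omega> (\<lambda>x. \<Sum>j=1..n. u j x))\<^sup>2"

definition R_fun ::
  "'a::euclidean_space set \<Rightarrow> (nat \<Rightarrow> real) \<Rightarrow> real \<Rightarrow> (nat \<Rightarrow> 'a \<Rightarrow> real) \<Rightarrow> nat \<Rightarrow> real" where
  "R_fun \<Omega> t \<beta> u n =
     1/2 * (\<Sum>k=1..n-2. (b_tilde t \<beta> (n - 1) (n - 2 - k) - b_tilde t \<beta> (n - 1) (n - 1 - k)
                           - b_tilde t \<beta> n (n - 1 - k) + b_tilde t \<beta> n (n - k)) *
                          (L2_norm \<Omega> (\<lambda>x. \<Sum>j=k+1..n-1. u j x))\<^sup>2)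
   + 1/2 * (b_tilde t \<beta> (n - 1) (n - 2) - b_tilde t \<beta> n (n - 1)) *
       (L2_norm \<Omega> (\<lambda>x. \<Sum>j=1..n-1. u j x))\<^sup>2"

section \<open>The linear relaxation scheme and its energies\<close>

text \<open>Half-level unknowns are shifted to natural-number indices:
  \<open>r n\<close> is the relaxation variable at level \<open>n - 1/2\<close> (so \<open>r 0\<close> and \<open>r 1\<close> are the two
  initial values), and \<open>\<mu> n\<close> is the chemical potential at level \<open>n - 1/2\<close> for \<open>n \<ge> 1\<close>.
  The equations are imposed on the whole space, all functions being periodic.\<close>

definition relaxation_scheme ::
  "nat \<Rightarrow> (nat \<Rightarrow> real) \<Rightarrow> real \<Rightarrow> real \<Rightarrow> real \<Rightarrow> real \<Rightarrow> real \<Rightarrow> real \<Rightarrow>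
   (nat \<Rightarrow> 'a::euclidean_space \<Rightarrow> real) \<Rightarrow> (nat \<Rightarrow> 'a \<Rightarrow> real) \<Rightarrow> (nat \<Rightarrow> 'a \<Rightarrow> real) \<Rightarrow> bool" where
  "relaxation_scheme N t \<alpha> M g S c1 c2 \<phi> r \<mu> \<longleftrightarrow>
     (\<forall>x. r 1 x = 1/2 * (\<phi> 0 x)\<^sup>2 - g/3 * \<phi> 0 x + c1 - S) \<and>
     (\<forall>x. r 0 x = 1/2 * (\<phi> 0 x)\<^sup>2 - g/3 * \<phi> 0 x + c1 - S) \<and>
     (\<forall>n<N. \<forall>x.
        L1plus t \<alpha> \<phi> n x = - M * \<mu> (n + 1) x \<and>
        \<mu> (n + 1) x = SH_op (half_avg \<phi> n) x
                       + 2 * (r (n + 1) x + S) * (half_avg \<phi> n x - g/3) + c2 \<and>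
        (r (n + 1) x + r n x) / 2 = 1/2 * (\<phi> n x)\<^sup>2 - g/3 * \<phi> n x + c1 - S)"

definition SH_energy :: "'a::euclidean_space set \<Rightarrow> real \<Rightarrow> real \<Rightarrow> ('a \<Rightarrow> real) \<Rightarrow> real" where
  "SH_energy \<Omega> g \<delta> u =
     (LINT x:\<Omega>|lebesgue.
        1/2 * u x * SH_op u x + 1/4 * (u x)^4 - g/3 * (u x)^3 + \<delta>/2 * (u x)^2)"

definition relaxed_energy ::
  "'a::euclidean_space set \<Rightarrow> real \<Rightarrow> real \<Rightarrow> real \<Rightarrow> real \<Rightarrow> real \<Rightarrow>
   ('a \<Rightarrow> real) \<Rightarrow> ('a \<Rightarrow> real) \<Rightarrow> real" where
  "relaxed_energy \<Omega> g S c1 c2 c3 u q =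
     (LINT x:\<Omega>|lebesgue.
        1/2 * u x * SH_op u x
        + 2 * (q x + S) * (1/2 * (u x)\<^sup>2 - g/3 * u x + c1 - S)
        - (q x)\<^sup>2 + c2 * u x)
     + (c3 + S\<^sup>2) * measure lebesgue \<Omega>"

text \<open>The variational energy at levels \<open>n\<close> (for \<open>\<phi>\<close>) and \<open>n - 1/2\<close> (for \<open>r\<close>), \<open>n \<ge> 1\<close>.\<close>

definition variational_energy ::
  "'a::euclidean_space set \<Rightarrow> (nat \<Rightarrow> real) \<Rightarrow> real \<Rightarrow> real \<Rightarrow> real \<Rightarrow> real \<Rightarrow> real \<Rightarrow> real \<Rightarrow> real \<Rightarrow>
   (nat \<Rightarrow> 'a \<Rightarrow> real) \<Rightarrow> (nat \<Rightarrow> 'a \<Rightarrow> real) \<Rightarrow> nat \<Rightarrow> real" where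
  "variational_energy \<Omega> t \<alpha> M g S c1 c2 c3 \<phi> r n =
     relaxed_energy \<Omega> g S c1 c2 c3 (\<phi> n) (r n) + 1 / M * A_fun \<Omega> t (1 - \<alpha>) (bdiff \<phi>) n"

end

(* The relaxation constraint makes the increment of the relaxed energy over one step equal to
   -1/M times the pairing of the discrete Caputo derivative with the increment of phi, because
   (1 + Delta)^2 is symmetric on periodic functions.

   (i) The kernel is, up to a positive factor, the cell average of |x - y|^(beta - 1), i.e. minus a mixed
   second difference of |x - y|^(1 + beta).  Writing |x|^p as a multiple of the integral of
   (1 - cos (w x)) w^(-1-p) over w > 0 turns the quadratic form into an integral of sums of squares.

   (ii) Summation by parts rewrites the pairing as A(n+1) - A(n) + R(n+1).  All coefficients of R except
   the one touching the diagonal are nonnegative by convexity.  The remaining one is monotone in the last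
   step ratio s; for s <= 1 it is bounded below, using concavity of h, by a multiple of s^beta minus
   (2 h(rho) - h(2 rho)), which is where H comes from, and for s >= 1 it is at least its value at
   s = 1, which is nonnegative for every rho. *)

theory Submission
  imports Defs
begin

section \<open>Convexity of power functions and the step-ratio condition\<close>

text \<open>Kernel positivity and summation by parts are proved for real sequences and applied at
  each fixed point x, where the increments of \<open>\<phi>\<close> are plain numbers; integration
  over the box comes last. Only the symmetry of (1 + Delta)^2 is a genuinely spatial fact. Off the
  diagonal a kernel is a slope of a divided difference of x^(1+\<beta>) between the ends of the
  newest cell, so comparing kernels of two levels means comparing consecutive slopes of one
  function. Concavity is therefore always used as an ordering of slopes. Adjacent cells touch, hence
  the distance 0 occurs as an endpoint, where x^\<beta> has no finite derivative; this is why
  derivatives are demanded in open intervals only and continuity up to the ends. The factor 2 in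
  \<open>b_tilde\<close> turns the diagonal entry, an integral over the triangle below x = y, into
  the average of the kernel over a whole square. This square contains the singularity, so the
  one-sided convexity of powers says nothing about it. This is the obstacle that a restriction on
  the step ratios has to overcome.\<close>

lemma concave_three_slopes:
  fixes f f' :: "real \<Rightarrow> real"
  assumes "x < y" "y < z" "continuous_on {x..z} f"
    and der: "\<And>u. x < u \<Longrightarrow> u < z \<Longrightarrow> (f has_real_derivative f' u) (at u)"
    and anti: "\<And>u v. x < u \<Longrightarrow> u \<le> v \<Longrightarrow> v < z \<Longrightarrow> f' v \<le> f' u"
  shows "(f z - f y) / (z - y) \<le> (f y - f x) / (y - x)"
proof -
  have diff: "f differentiable at u" if "x < u" "u < z" for u
    using der[OF that] by (auto simp: real_differentiable_def)
  have "\<exists>l u. x < u \<and> u < y \<and> DERIV f u :> l \<and> f y - f x = (y - x) * l"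
    using assms by (intro MVT) (auto intro: continuous_on_subset intro!: diff)
  then obtain l u where u: "x < u" "u < y" "DERIV f u :> l" "f y - f x = (y - x) * l"
    by blast
  have "\<exists>l v. y < v \<and> v < z \<and> DERIV f v :> l \<and> f z - f y = (z - y) * l"
    using assms by (intro MVT) (auto intro: continuous_on_subset intro!: diff)
  then obtain k v where v: "y < v" "v < z" "DERIV f v :> k" "f z - f y = (z - y) * k"
    by blast
  have "l = f' u" "k = f' v"
    using der[of u] der[of v] u v DERIV_unique assms(1,2) by force+
  then show ?thesis
    using u v anti[of u v] assms(1,2) by simp
qed

lemma continuous_on_powr_nonneg:
  fixes f :: "'a::topological_space \<Rightarrow> real"
  assumes "continuous_on A f" "0 < p" "\<And>x. x \<in> A \<Longrightarrow> 0 \<le> f x"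
  shows "continuous_on A (\<lambda>x. f x powr p)"
  using assms by (intro continuous_on_powr') auto

lemma powr_diff_antimono:
  fixes \<beta> :: real
  assumes "0 < \<beta>" "\<beta> < 1" "0 \<le> l" "0 \<le> x" "x \<le> y"
  shows "(y + l) powr \<beta> - y powr \<beta> \<le> (x + l) powr \<beta> - x powr \<beta>"
proof (rule DERIV_nonpos_imp_decreasing_open[OF \<open>x \<le> y\<close>, of "\<lambda>u. (u + l) powr \<beta> - u powr \<beta>"])
  fix u assume u: "x < u" "u < y"
  have "((\<lambda>u. (u + l) powr \<beta> - u powr \<beta>) has_real_derivative
      \<beta> * (u + l) powr (\<beta> - 1) - \<beta> * u powr (\<beta> - 1)) (at u)"
    using u assms by (auto intro!: derivative_eq_intros)
  moreover have "(u + l) powr (\<beta> - 1) \<le> u powr (\<beta> - 1)"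
    using u assms by (intro powr_mono2') auto
  ultimately show "\<exists>d. ((\<lambda>u. (u + l) powr \<beta> - u powr \<beta>) has_real_derivative d) (at u) \<and> d \<le> 0"
    using assms by (intro exI[of _ "\<beta> * (u + l) powr (\<beta> - 1) - \<beta> * u powr (\<beta> - 1)"] conjI) auto
next
  show "continuous_on {x..y} (\<lambda>u. (u + l) powr \<beta> - u powr \<beta>)"
    using assms by (intro continuous_on_add continuous_on_diff continuous_on_mult continuous_on_divide
        continuous_on_powr_nonneg continuous_on_const continuous_on_id) auto
qed

lemma powr_convex_three_slopes:
  fixes \<beta> :: real
  assumes "\<beta> < 0" "0 < x" "x < y" "y < z"
  shows "(y powr \<beta> - x powr \<beta>) / (y - x) \<le> (z powr \<beta> - y powr \<beta>) / (z - y)"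
proof -
  have "((- (z powr \<beta>)) - (- (y powr \<beta>))) / (z - y) \<le> ((- (y powr \<beta>)) - (- (x powr \<beta>))) / (y - x)"
  proof (rule concave_three_slopes[where f = "\<lambda>u. - (u powr \<beta>)" and f' = "\<lambda>u. - (\<beta> * u powr (\<beta> - 1))"])
    show "continuous_on {x..z} (\<lambda>u. - (u powr \<beta>))"
      using assms by (intro continuous_intros) auto
  next
    fix u assume "x < u" "u < z"
    then show "((\<lambda>u. - (u powr \<beta>)) has_real_derivative - (\<beta> * u powr (\<beta> - 1))) (at u)"
      using assms by (auto intro!: derivative_eq_intros)
  next
    fix u v assume uv: "x < u" "u \<le> v" "v < z"
    have "v powr (\<beta> - 1) \<le> u powr (\<beta> - 1)"
      using assms uv by (intro powr_mono2') auto
    then show "- (\<beta> * v powr (\<beta> - 1)) \<le> - (\<beta> * u powr (\<beta> - 1))"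
      using assms by simp
  qed (use assms in auto)
  then show ?thesis
    by (simp add: minus_divide_left diff_divide_distrib algebra_simps)
qed

text \<open>Up to the factor 1 + \<beta> the mean of y^\<beta> over [x, x + l]; here x is the
  distance from the current time to the right end of a past cell of length l.\<close>

definition powr_slope :: "real \<Rightarrow> real \<Rightarrow> real \<Rightarrow> real" where
  "powr_slope \<beta> l x = ((x + l) powr (1 + \<beta>) - x powr (1 + \<beta>)) / l"

text \<open>Minus (a + l) times a second divided difference of x^(1+\<beta>). It arises from
  subtracting two kernels of one level that belong to neighbouring cells; the cell of length a is
  the later one, nearer to the current time.\<close>

definition slope_gap :: "real \<Rightarrow> real \<Rightarrow> real \<Rightarrow> real \<Rightarrow> real" where
  "slope_gap \<beta> a l x = powr_slope \<beta> a x - powr_slope \<beta> l (x + a)"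

lemma continuous_on_powr_slope [continuous_intros]:
  assumes "continuous_on A f" "0 < \<beta>" "0 < l" "\<And>x. x \<in> A \<Longrightarrow> 0 \<le> f x"
  shows "continuous_on A (\<lambda>x. powr_slope \<beta> l (f x))"
  unfolding powr_slope_def using assms
  by (intro continuous_on_add continuous_on_diff continuous_on_mult continuous_on_divide
        continuous_on_powr_nonneg continuous_on_const continuous_on_id) (auto simp: less_eq_real_def add_nonneg_pos)

lemma powr_slope_deriv:
  assumes "0 < l" "0 < x" "0 < \<beta>"
  shows "(powr_slope \<beta> l has_real_derivative
    (1 + \<beta>) * (((x + l) powr \<beta> - x powr \<beta>) / l)) (at x)"
  unfolding powr_slope_def using assms
  by (auto intro!: derivative_eq_intros simp: field_simps)

text \<open>The derivative is proportional to (x + l)^\<beta> - x^\<beta>, which decreases because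
  y^\<beta> is concave.\<close>

lemma powr_slope_concave:
  assumes "0 < \<beta>" "\<beta> < 1" "0 < l" "0 \<le> x" "x < y" "y < z"
  shows "(powr_slope \<beta> l z - powr_slope \<beta> l y) / (z - y)
    \<le> (powr_slope \<beta> l y - powr_slope \<beta> l x) / (y - x)"
proof (rule concave_three_slopes)
  fix u v assume uv: "x < u" "u \<le> v" "v < z"
  show "(1 + \<beta>) * (((v + l) powr \<beta> - v powr \<beta>) / l) \<le> (1 + \<beta>) * (((u + l) powr \<beta> - u powr \<beta>) / l)"
    using assms uv powr_diff_antimono[of \<beta> l u v] by (intro mult_left_mono divide_right_mono) auto
next
  show "continuous_on {x..z} (powr_slope \<beta> l)"
    using assms by (intro continuous_on_powr_slope) auto
  show "(powr_slope \<beta> l has_real_derivative (1 + \<beta>) * (((u + l) powr \<beta> - u powr \<beta>) / l)) (at u)"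
    if "x < u" for u
    using that assms by (intro powr_slope_deriv) auto
qed (use assms in auto)

text \<open>One order further: up to positive factors the derivative of the gap is the same gap
  formed with y^\<beta>, and the derivative of that is the gap formed with y^(\<beta> - 1), which is
  nonpositive because y^(\<beta> - 1) is convex.\<close>

lemma slope_gap_concave:
  assumes "0 < \<beta>" "\<beta> < 1" "0 < a" "0 < l" "0 \<le> x" "x < y" "y < z"
  shows "(slope_gap \<beta> a l z - slope_gap \<beta> a l y) / (z - y)
    \<le> (slope_gap \<beta> a l y - slope_gap \<beta> a l x) / (y - x)"
proof (rule concave_three_slopes)
  let ?e = "\<lambda>u. ((u + a) powr \<beta> - u powr \<beta>) / a - ((u + a + l) powr \<beta> - (u + a) powr \<beta>) / l"
  let ?f' = "\<lambda>u. (1 + \<beta>) * ?e u"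
  show "continuous_on {x..z} (slope_gap \<beta> a l)"
    unfolding slope_gap_def using assms by (auto intro!: continuous_intros)
  fix u assume u: "x < u" "u < z"
  have "((\<lambda>u. powr_slope \<beta> l (u + a)) has_real_derivative
      (1 + \<beta>) * (((u + a + l) powr \<beta> - (u + a) powr \<beta>) / l)) (at u)"
    using powr_slope_deriv[of l "u + a" \<beta>] assms u DERIV_shift by fastforce
  then show "(slope_gap \<beta> a l has_real_derivative ?f' u) (at u)"
    unfolding slope_gap_def using powr_slope_deriv[of a u \<beta>] assms u
    by (auto intro!: derivative_eq_intros simp: right_diff_distrib)
next
  let ?e = "\<lambda>u. ((u + a) powr \<beta> - u powr \<beta>) / a - ((u + a + l) powr \<beta> - (u + a) powr \<beta>) / l"
  fix u v assume uv: "x < u" "u \<le> v" "v < z"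
  have "?e v \<le> ?e u"
  proof (rule DERIV_nonpos_imp_decreasing_open[OF \<open>u \<le> v\<close>, of ?e])
    fix y assume y: "u < y" "y < v"
    have "(?e has_real_derivative
        \<beta> * (((y + a) powr (\<beta> - 1) - y powr (\<beta> - 1)) / a
          - ((y + a + l) powr (\<beta> - 1) - (y + a) powr (\<beta> - 1)) / l)) (at y)"
      using y uv assms by (auto intro!: derivative_eq_intros simp: field_simps)
    moreover have "((y + a) powr (\<beta> - 1) - y powr (\<beta> - 1)) / a
        - ((y + a + l) powr (\<beta> - 1) - (y + a) powr (\<beta> - 1)) / l \<le> 0"
      using powr_convex_three_slopes[of "\<beta> - 1" y "y + a" "y + a + l"] y uv assms by simp
    ultimately show "\<exists>d. (?e has_real_derivative d) (at y) \<and> d \<le> 0"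
      using assms by (meson mult_le_0_iff less_imp_le)
  next
    show "continuous_on {u..v} ?e"
      using assms uv by (auto intro!: continuous_intros)
  qed
  then show "(1 + \<beta>) * ?e v \<le> (1 + \<beta>) * ?e u"
    using assms by (intro mult_left_mono) auto
qed (use assms in auto)

lemma h_fun_powr_slope: "0 \<le> s \<Longrightarrow> h_fun \<beta> s = powr_slope \<beta> 1 s - 1"
  by (simp add: h_fun_def powr_slope_def add.commute)

lemma h_fun_concave:
  assumes "0 < \<beta>" "\<beta> < 1" "0 \<le> x" "x < y" "y < z"
  shows "(h_fun \<beta> z - h_fun \<beta> y) / (z - y) \<le> (h_fun \<beta> y - h_fun \<beta> x) / (y - x)"
  using powr_slope_concave[of \<beta> 1 x y z] assms by (simp add: h_fun_powr_slope)

text \<open>The left side vanishes at s = 0 and equals 2 at s = 1, since h(1) = 2^(1+\<beta>) - 2;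
  so 2 * s is its chord on [0, 1], and this fixes the constant 4 - 2^(1+\<beta>).\<close>

lemma h_fun_le_chord:
  assumes b: "0 < \<beta>" "\<beta> < 1" and s: "0 < s" "s \<le> 1"
  shows "h_fun \<beta> s + (4 - 2 powr (1 + \<beta>)) * s powr (1 + \<beta>) \<le> 2 * s"
proof -
  \<comment> \<open>\<open>?f\<close> is the left side minus the right side, divided by
    s^(1+\<beta>) and written in y = 1/s. It vanishes at y = 1, and it decreases by the mean value
    theorem and 1 + \<beta> \<le> 2.\<close>
  let ?f = "\<lambda>y::real. (1 + y) powr (1 + \<beta>) - y powr (1 + \<beta>) - 2 * y powr \<beta> + 3 - 2 powr (1 + \<beta>)"
  define y where "y = 1 / s"
  have y: "1 \<le> y" using s by (simp add: y_def)
  have "?f y \<le> ?f 1"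
  proof (rule DERIV_nonpos_imp_decreasing_open[OF y, of ?f])
    fix u assume u: "1 < u" "u < y"
    have der: "(?f has_real_derivative
        (1 + \<beta>) * ((1 + u) powr \<beta> - u powr \<beta>) - 2 * \<beta> * u powr (\<beta> - 1)) (at u)"
      using u by (auto intro!: derivative_eq_intros simp: algebra_simps)
    have "\<exists>l z. u < z \<and> z < u + 1 \<and> DERIV (\<lambda>x. x powr \<beta>) z :> l \<and>
        (u + 1) powr \<beta> - u powr \<beta> = (u + 1 - u) * l"
      using u by (intro MVT) (auto intro!: continuous_intros derivative_eq_intros
          simp: real_differentiable_def)
    then obtain l z where z: "u < z" "z < u + 1" "DERIV (\<lambda>x. x powr \<beta>) z :> l"
      "(u + 1) powr \<beta> - u powr \<beta> = l" by auto
    have "DERIV (\<lambda>x. x powr \<beta>) z :> \<beta> * z powr (\<beta> - 1)"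
      using z u by (auto intro!: derivative_eq_intros)
    then have "l = \<beta> * z powr (\<beta> - 1)" using z DERIV_unique by blast
    also have "\<dots> \<le> \<beta> * u powr (\<beta> - 1)"
      using z u b by (intro mult_left_mono powr_mono2') auto
    finally have "(1 + \<beta>) * ((1 + u) powr \<beta> - u powr \<beta>) \<le> (1 + \<beta>) * (\<beta> * u powr (\<beta> - 1))"
      using z b by (intro mult_left_mono) (auto simp: add.commute)
    also have "\<dots> \<le> 2 * (\<beta> * u powr (\<beta> - 1))"
      using b by (intro mult_right_mono) auto
    finally show "\<exists>d. (?f has_real_derivative d) (at u) \<and> d \<le> 0"
      using der by (intro exI conjI) (assumption, simp)
  next
    show "continuous_on {1..y} ?f" by (auto intro!: continuous_intros)
  qed
  then have "?f y \<le> 0" by simp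
  then have "s powr (1 + \<beta>) * ?f y \<le> 0"
    by (simp add: mult_nonneg_nonpos)
  moreover have "s powr (1 + \<beta>) * (1 + y) powr (1 + \<beta>) = (1 + s) powr (1 + \<beta>)"
    using s by (simp add: powr_mult[symmetric] y_def distrib_left add.commute)
  moreover have "s powr (1 + \<beta>) * y powr (1 + \<beta>) = 1"
    using s by (simp add: powr_mult[symmetric] y_def)
  moreover have "s powr (1 + \<beta>) * y powr \<beta> = s"
    using s by (simp add: powr_add y_def powr_divide)
  ultimately show ?thesis
    unfolding h_fun_def by (simp add: algebra_simps)
qed

text \<open>This settles the case of two equal last steps for every \<rho>. It says that the base of
  the outer power in \<open>H_fun\<close> never exceeds 1.\<close>

lemma h_fun_double_bound:
  assumes b: "0 < \<beta>" "\<beta> < 1" and r: "0 < \<rho>"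
  shows "2 * h_fun \<beta> \<rho> - h_fun \<beta> (2 * \<rho>) \<le> (4 - 2 powr (1 + \<beta>)) * \<rho> powr \<beta>"
proof -
  \<comment> \<open>Again the difference of the two sides divided by \<rho>^(1+\<beta>), in the
    variable y = 1/\<rho>; it vanishes at y = 0.\<close>
  let ?f = "\<lambda>y::real. (2 powr (1 + \<beta>) - 4) * y + 2 * (1 + y) powr (1 + \<beta>) - (2 + y) powr (1 + \<beta>)
    + 2 powr (1 + \<beta>) - 2 - y powr (1 + \<beta>)"
  define y where "y = 1 / \<rho>"
  have y: "0 \<le> y" using r by (simp add: y_def)
  have two: "(2::real) powr \<beta> < 2" using b powr_less_mono[of \<beta> 1 "2::real"] by simp
  have "?f y \<le> ?f 0"
  proof (rule DERIV_nonpos_imp_decreasing_open[OF y, of ?f])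
    fix u assume u: "0 < u" "u < y"
    have der: "(?f has_real_derivative 2 powr (1 + \<beta>) - 4
        + (1 + \<beta>) * (2 * (1 + u) powr \<beta> - (2 + u) powr \<beta> - u powr \<beta>)) (at u)"
      using u by (auto intro!: derivative_eq_intros simp: algebra_simps)
    \<comment> \<open>A negative second difference of y^\<beta>; it decreases in u because
      y^(\<beta> - 1) is convex, so its largest value is the one at 0. Multiplied by 2 instead of 1
      + \<beta>, that value cancels the constant 2^(1+\<beta>) - 4 exactly.\<close>
    have "2 * (1 + u) powr \<beta> - (2 + u) powr \<beta> - u powr \<beta> \<le> 2 - 2 powr \<beta>"
    proof -
      let ?g = "\<lambda>u. 2 * (1 + u) powr \<beta> - (2 + u) powr \<beta> - u powr \<beta>"
      have "?g u \<le> ?g 0"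
      proof (rule DERIV_nonpos_imp_decreasing_open[of 0 u ?g])
        fix v assume v: "0 < v" "v < u"
        have "(?g has_real_derivative
          \<beta> * (2 * (1 + v) powr (\<beta> - 1) - (2 + v) powr (\<beta> - 1) - v powr (\<beta> - 1))) (at v)"
          using v by (auto intro!: derivative_eq_intros simp: algebra_simps)
        moreover have "2 * (1 + v) powr (\<beta> - 1) - (2 + v) powr (\<beta> - 1) - v powr (\<beta> - 1) \<le> 0"
          using powr_convex_three_slopes[of "\<beta> - 1" v "1 + v" "2 + v"] v b by simp
        ultimately show "\<exists>d. (?g has_real_derivative d) (at v) \<and> d \<le> 0"
          using b by (meson mult_le_0_iff less_imp_le)
      next
        show "continuous_on {0..u} ?g"
          using b by (intro continuous_on_add continuous_on_diff continuous_on_mult continuous_on_divide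
        continuous_on_powr_nonneg continuous_on_const continuous_on_id) auto
      qed (use u in auto)
      then show ?thesis using b by simp
    qed
    then have "(1 + \<beta>) * (2 * (1 + u) powr \<beta> - (2 + u) powr \<beta> - u powr \<beta>) \<le> (1 + \<beta>) * (2 - 2 powr \<beta>)"
      using b by (intro mult_left_mono) auto
    also have "\<dots> \<le> 2 * (2 - 2 powr \<beta>)"
      using b two by (intro mult_right_mono) auto
    finally show "\<exists>d. (?f has_real_derivative d) (at u) \<and> d \<le> 0"
      using der by (intro exI conjI) (assumption, simp add: powr_add)
  next
    show "continuous_on {0..y} ?f"
      using b by (intro continuous_on_add continuous_on_diff continuous_on_mult continuous_on_divide
        continuous_on_powr_nonneg continuous_on_const continuous_on_id) auto
  qed
  then have "?f y \<le> 0" using b by simp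
  then have "\<rho> powr (1 + \<beta>) * ?f y \<le> 0"
    by (simp add: mult_nonneg_nonpos)
  moreover have "\<rho> powr (1 + \<beta>) * ?f y = (2 powr (1 + \<beta>) - 4) * (\<rho> powr (1 + \<beta>) * y)
      + 2 * (\<rho> powr (1 + \<beta>) * (1 + y) powr (1 + \<beta>)) - \<rho> powr (1 + \<beta>) * (2 + y) powr (1 + \<beta>)
      + \<rho> powr (1 + \<beta>) * 2 powr (1 + \<beta>) - 2 * \<rho> powr (1 + \<beta>)
      - \<rho> powr (1 + \<beta>) * y powr (1 + \<beta>)"
    by (simp add: algebra_simps)
  moreover have "\<rho> powr (1 + \<beta>) * (1 + y) powr (1 + \<beta>) = (1 + \<rho>) powr (1 + \<beta>)"
    using r by (simp add: powr_mult[symmetric] y_def distrib_left add.commute)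
  moreover have "\<rho> powr (1 + \<beta>) * (2 + y) powr (1 + \<beta>) = (1 + 2 * \<rho>) powr (1 + \<beta>)"
    using r by (simp add: powr_mult[symmetric] y_def distrib_left add.commute mult.commute)
  moreover have "\<rho> powr (1 + \<beta>) * y powr (1 + \<beta>) = 1"
    using r by (simp add: powr_mult[symmetric] y_def)
  moreover have "\<rho> powr (1 + \<beta>) * y = \<rho> powr \<beta>"
    using r by (simp add: powr_add y_def)
  moreover have "\<rho> powr (1 + \<beta>) * 2 powr (1 + \<beta>) = (2 * \<rho>) powr (1 + \<beta>)"
    using r by (simp add: powr_mult)
  ultimately have "(2 powr (1 + \<beta>) - 4) * \<rho> powr \<beta> + 2 * (1 + \<rho>) powr (1 + \<beta>)
      - (1 + 2 * \<rho>) powr (1 + \<beta>) + (2 * \<rho>) powr (1 + \<beta>) - 2 * \<rho> powr (1 + \<beta>) - 1 \<le> 0"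
    by (simp only:)
  then show ?thesis
    unfolding h_fun_def by (simp add: algebra_simps)
qed

text \<open>For consecutive cells of lengths 1, \<rho> and \<rho> * s, this links the concavity of
  \<open>slope_gap\<close> to the function h in which the step-ratio condition is written.\<close>

lemma slope_gap_h_fun:
  assumes b: "0 < \<beta>" and r: "0 < \<rho>" and s: "0 < s"
  shows "slope_gap \<beta> \<rho> 1 (\<rho> * s) - slope_gap \<beta> \<rho> 1 0
    = \<rho> powr \<beta> * h_fun \<beta> s - h_fun \<beta> (\<rho> + \<rho> * s) + h_fun \<beta> \<rho>"
proof -
  have "(\<rho> * s + \<rho>) powr (1 + \<beta>) = \<rho> * (\<rho> powr \<beta> * (1 + s) powr (1 + \<beta>))"
    using r s powr_mult[of \<rho> "1 + s" "1 + \<beta>"] by (simp add: algebra_simps powr_add)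
  moreover have "(\<rho> * s) powr (1 + \<beta>) = \<rho> * (\<rho> powr \<beta> * s powr (1 + \<beta>))"
    using r s powr_mult[of \<rho> s "1 + \<beta>"] by (simp add: powr_add)
  moreover have "\<rho> powr (1 + \<beta>) = \<rho> * \<rho> powr \<beta>"
    using r by (simp add: powr_add)
  ultimately show ?thesis
    using r b by (simp add: slope_gap_def powr_slope_def h_fun_def field_simps)
qed

lemma step_ratio_inequality:
  assumes b: "0 < \<beta>" "\<beta> < 1" and r: "0 < \<rho>" and s: "0 < s" "H_fun \<beta> \<rho> \<le> s"
  shows "(\<rho> powr \<beta> * h_fun \<beta> s - h_fun \<beta> (\<rho> + \<rho> * s) + h_fun \<beta> \<rho>) / s
    \<le> 2 * \<rho> powr \<beta> - h_fun \<beta> \<rho>"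
proof -
  define K where "K = 4 - 2 powr (1 + \<beta>)"
  define X where "X = 2 * h_fun \<beta> \<rho> - h_fun \<beta> (2 * \<rho>)"
  let ?G = "\<lambda>s. (\<rho> powr \<beta> * h_fun \<beta> s - h_fun \<beta> (\<rho> + \<rho> * s) + h_fun \<beta> \<rho>) / s"
  have K: "K > 0"
    using powr_less_mono[of "1 + \<beta>" 2 "2::real"] b by (simp add: K_def)
  have X: "X \<le> K * \<rho> powr \<beta>"
    using h_fun_double_bound[OF b r] by (simp add: X_def K_def)
  \<comment> \<open>Since h(1) = 2 - K, the slack at s = 1 is K * \<rho>^\<beta> - X, which is the
    denominator minus the numerator of the base in \<open>H_fun\<close>.\<close>
  have G1: "?G 1 = 2 * \<rho> powr \<beta> - h_fun \<beta> \<rho> - (K * \<rho> powr \<beta> - X)"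
    by (simp add: K_def X_def h_fun_def algebra_simps)
  show ?thesis
  proof (cases "s < 1")
    case True
    have "X \<le> K * \<rho> powr \<beta> * s powr \<beta>"
    \<comment> \<open>The power 1/\<beta> in \<open>H_fun\<close> is undone only for a positive
      base; for X \<le> 0 the bound is immediate.\<close>
    proof (cases "X \<le> 0")
      case True
      moreover have "0 \<le> K * \<rho> powr \<beta> * s powr \<beta>"
        using K by simp
      ultimately show ?thesis by linarith
    next
      case False
      then have pos: "0 < X / (\<rho> powr \<beta> * K)"
        using K r by simp
      have "((X / (\<rho> powr \<beta> * K)) powr (1 / \<beta>)) powr \<beta> \<le> s powr \<beta>"
        using s(2) b by (intro powr_mono2) (auto simp: H_fun_def K_def X_def)
      moreover have "((X / (\<rho> powr \<beta> * K)) powr (1 / \<beta>)) powr \<beta> = X / (\<rho> powr \<beta> * K)"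
        using b abs_of_pos[OF pos] by (simp add: powr_powr abs_divide)
      ultimately have "X / (\<rho> powr \<beta> * K) \<le> s powr \<beta>"
        by simp
      then show ?thesis
        using K r by (simp add: field_simps)
    qed
    \<comment> \<open>As s < 1, the point \<rho> + \<rho> * s lies between \<rho> and 2 * \<rho>,
      and concavity makes the slope of h over the shorter interval the larger one; the common factor
      \<rho> cancels.\<close>
    moreover have "(h_fun \<beta> (2 * \<rho>) - h_fun \<beta> \<rho>) \<le> (h_fun \<beta> (\<rho> + \<rho> * s) - h_fun \<beta> \<rho>) / s"
    proof -
      define A B C where "A = h_fun \<beta> \<rho>" "B = h_fun \<beta> (\<rho> + \<rho> * s)" "C = h_fun \<beta> (2 * \<rho>)"
      have "(C - B) / (2 * \<rho> - (\<rho> + \<rho> * s)) \<le> (B - A) / (\<rho> + \<rho> * s - \<rho>)"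
        unfolding A_B_C_def using r s True by (intro h_fun_concave b) auto
      then have "(C - B) / (\<rho> * (1 - s)) \<le> (B - A) / (\<rho> * s)"
        by (simp add: algebra_simps)
      then have "\<rho> * ((C - B) / (\<rho> * (1 - s))) \<le> \<rho> * ((B - A) / (\<rho> * s))"
        using r by (intro mult_left_mono) auto
      then have "(C - B) / (1 - s) \<le> (B - A) / s"
        using r by simp
      then have "(C - A) * s \<le> B - A"
        using s True by (simp add: field_simps)
      then show ?thesis
        unfolding A_B_C_def[symmetric] using s by (simp add: field_simps)
    qed
    moreover have "\<rho> powr \<beta> * (h_fun \<beta> s / s) \<le> \<rho> powr \<beta> * (2 - K * s powr \<beta>)"
      using h_fun_le_chord[OF b s(1)] True s
      by (intro mult_left_mono) (auto simp: K_def field_simps powr_add)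
    ultimately show ?thesis
      by (simp add: X_def add_divide_distrib diff_divide_distrib algebra_simps)
  next
    case False
    \<comment> \<open>\<open>?G s\<close> is \<rho> times the slope of \<open>slope_gap\<close> from
      0 to \<rho> * s, so by concavity it cannot grow with s.\<close>
    have "?G s \<le> ?G 1"
    proof (cases "s = 1")
      case False
      with \<open>\<not> s < 1\<close> have s1: "1 < s" by simp
      define N1 Ns where "N1 = slope_gap \<beta> \<rho> 1 (\<rho> * 1) - slope_gap \<beta> \<rho> 1 0"
        "Ns = slope_gap \<beta> \<rho> 1 (\<rho> * s) - slope_gap \<beta> \<rho> 1 0"
      have "(slope_gap \<beta> \<rho> 1 (\<rho> * s) - slope_gap \<beta> \<rho> 1 (\<rho> * 1)) / (\<rho> * s - \<rho> * 1)
          \<le> (slope_gap \<beta> \<rho> 1 (\<rho> * 1) - slope_gap \<beta> \<rho> 1 0) / (\<rho> * 1 - 0)"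
        using r s1 by (intro slope_gap_concave b) auto
      then have "(Ns - N1) / (\<rho> * (s - 1)) \<le> N1 / \<rho>"
        by (simp add: N1_Ns_def algebra_simps)
      then have "\<rho> * ((Ns - N1) / (\<rho> * (s - 1))) \<le> \<rho> * (N1 / \<rho>)"
        using r by (intro mult_left_mono) auto
      then have "(Ns - N1) / (s - 1) \<le> N1"
        using r by simp
      then have "Ns / s \<le> N1 / 1"
        using s1 by (simp add: field_simps)
      then show ?thesis
        unfolding N1_Ns_def using slope_gap_h_fun[OF b(1) r, of s] slope_gap_h_fun[OF b(1) r, of 1] s1 by simp
    qed simp
    then show ?thesis using G1 X by linarith
  qed
qed

section \<open>The convolution kernels\<close>

text \<open>For d = s the kernel is singular at the right end, so the antiderivative is
  differentiated in the interior only. Nonnegativity then gives absolute integrability, which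
  carries the gauge integral over to the Lebesgue integral.\<close>

lemma omega_integral:
  assumes b: "0 < \<beta>" and le: "c \<le> d" "d \<le> s"
  shows "(LINT u:{c..d}|lebesgue. omega \<beta> (s - u))
    = ((s - c) powr \<beta> - (s - d) powr \<beta>) / Gamma (1 + \<beta>)"
proof -
  have G: "Gamma (1 + \<beta>) = \<beta> * Gamma \<beta>"
    using b Gamma_plus1[of \<beta>] by (auto simp: add.commute nonpos_Ints_def)
  have pos: "Gamma \<beta> > 0" using b by (simp add: Gamma_real_pos)
  then have G1: "Gamma \<beta> \<noteq> 0" by linarith
  have G0: "Gamma (1 + \<beta>) \<noteq> 0" using b Gamma_real_pos[of "1 + \<beta>"] by linarith
  have "((\<lambda>u. omega \<beta> (s - u)) has_integral
      - ((s - d) powr \<beta> / Gamma (1 + \<beta>)) - - ((s - c) powr \<beta> / Gamma (1 + \<beta>))) {c..d}"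
  proof (rule fundamental_theorem_of_calculus_interior[OF le(1)])
    show "continuous_on {c..d} (\<lambda>u. - ((s - u) powr \<beta> / Gamma (1 + \<beta>)))"
      using le b G0 by (intro continuous_on_minus continuous_on_divide continuous_on_powr_nonneg
          continuous_on_diff continuous_on_const continuous_on_id) auto
    fix u assume "u \<in> {c<..<d}"
    then have "((\<lambda>u. - ((s - u) powr \<beta> / Gamma (1 + \<beta>))) has_real_derivative omega \<beta> (s - u)) (at u)"
      using le b G1 by (auto intro!: derivative_eq_intros simp: omega_def G field_simps)
    then show "((\<lambda>u. - ((s - u) powr \<beta> / Gamma (1 + \<beta>))) has_vector_derivative omega \<beta> (s - u)) (at u)"
      by (simp add: has_real_derivative_iff_has_vector_derivative)
  qed
  moreover from this have "(\<lambda>u. omega \<beta> (s - u)) absolutely_integrable_on {c..d}"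
    using pos by (intro nonnegative_absolutely_integrable_1) (auto simp: omega_def integrable_on_def)
  ultimately show ?thesis
    by (auto simp: set_lebesgue_integral_eq_integral integral_unique diff_divide_distrib)
qed

lemma powr_integral:
  fixes \<beta> :: real
  assumes b: "0 < \<beta>" and le: "c \<le> x" "x \<le> y"
  shows "set_integrable lebesgue {x..y} (\<lambda>s. (s - c) powr \<beta>)"
    and "(LINT s:{x..y}|lebesgue. (s - c) powr \<beta>)
      = ((y - c) powr (1 + \<beta>) - (x - c) powr (1 + \<beta>)) / (1 + \<beta>)"
proof -
  have "((\<lambda>s. (s - c) powr \<beta>) has_integral
      (y - c) powr (1 + \<beta>) / (1 + \<beta>) - (x - c) powr (1 + \<beta>) / (1 + \<beta>)) {x..y}"
  proof (rule fundamental_theorem_of_calculus_interior[OF le(2)])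
    show "continuous_on {x..y} (\<lambda>s. (s - c) powr (1 + \<beta>) / (1 + \<beta>))"
      using le b by (intro continuous_on_divide continuous_on_powr_nonneg
          continuous_on_diff continuous_on_const continuous_on_id) auto
    fix u assume "u \<in> {x<..<y}"
    then have "((\<lambda>s. (s - c) powr (1 + \<beta>) / (1 + \<beta>)) has_real_derivative (u - c) powr \<beta>) (at u)"
      using le b by (auto intro!: derivative_eq_intros)
    then show "((\<lambda>s. (s - c) powr (1 + \<beta>) / (1 + \<beta>)) has_vector_derivative (u - c) powr \<beta>) (at u)"
      by (simp add: has_real_derivative_iff_has_vector_derivative)
  qed
  moreover from this show "set_integrable lebesgue {x..y} (\<lambda>s. (s - c) powr \<beta>)"
    by (intro nonnegative_absolutely_integrable_1) (auto simp: integrable_on_def)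
  ultimately show "(LINT s:{x..y}|lebesgue. (s - c) powr \<beta>)
      = ((y - c) powr (1 + \<beta>) - (x - c) powr (1 + \<beta>)) / (1 + \<beta>)"
    by (auto simp: set_lebesgue_integral_eq_integral integral_unique diff_divide_distrib)
qed

lemma Gamma_plus_two: "0 < \<beta> \<Longrightarrow> Gamma (2 + \<beta>) = (1 + \<beta>) * Gamma (1 + \<beta>)" for \<beta> :: real
  using Gamma_plus1[of "1 + \<beta>"] by (auto simp: add.commute add.left_commute nonpos_Ints_def)

lemma b_kernel_diag:
  assumes b: "0 < \<beta>" and n: "t (n - 1) < t n"
  shows "b_kernel t \<beta> n 0 = step t n powr (1 + \<beta>) / (step t n)\<^sup>2 / Gamma (2 + \<beta>)"
proof -
  have "(LINT s:{t (n - 1)..t n}|lebesgue. (LINT s':{t (n - 1)..min (t n) s}|lebesgue. omega \<beta> (s - s')))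
    = (LINT s:{t (n - 1)..t n}|lebesgue. (s - t (n - 1)) powr \<beta> / Gamma (1 + \<beta>))"
  proof (rule set_lebesgue_integral_cong)
    show "\<forall>s. s \<in> {t (n - 1)..t n} \<longrightarrow> (LINT s':{t (n - 1)..min (t n) s}|lebesgue. omega \<beta> (s - s'))
      = (s - t (n - 1)) powr \<beta> / Gamma (1 + \<beta>)"
      using omega_integral[OF b, of "t (n - 1)"] b by (auto simp: min_absorb2)
  qed auto
  also have "\<dots> = step t n powr (1 + \<beta>) / Gamma (2 + \<beta>)"
    using powr_integral[OF b, of "t (n - 1)" "t (n - 1)" "t n"] n b
    by (simp add: Gamma_plus_two step_def)
  finally show ?thesis
    by (simp add: b_kernel_def power2_eq_square)
qed

text \<open>Cell k ends before cell n begins, so the cap \<open>min (t k) s\<close> equals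
  \<open>t k\<close>. The factor 1 / \<open>step t k\<close> is absorbed into
  \<open>powr_slope\<close>, which leaves the slope of that function between the two ends of cell n;
  monotonicity in the level thereby becomes concavity.\<close>

lemma b_kernel_off_diag:
  assumes b: "0 < \<beta>" and n: "t (n - 1) < t n" and k: "t (k - 1) < t k" "t k \<le> t (n - 1)" "k \<le> n"
  shows "b_kernel t \<beta> n (n - k) = (powr_slope \<beta> (step t k) (t n - t k)
    - powr_slope \<beta> (step t k) (t (n - 1) - t k)) / step t n / Gamma (2 + \<beta>)"
proof -
  have "(LINT s:{t (n - 1)..t n}|lebesgue. (LINT s':{t (k - 1)..min (t k) s}|lebesgue. omega \<beta> (s - s')))
    = (LINT s:{t (n - 1)..t n}|lebesgue. ((s - t (k - 1)) powr \<beta> - (s - t k) powr \<beta>) / Gamma (1 + \<beta>))"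
  proof (rule set_lebesgue_integral_cong)
    show "\<forall>s. s \<in> {t (n - 1)..t n} \<longrightarrow> (LINT s':{t (k - 1)..min (t k) s}|lebesgue. omega \<beta> (s - s'))
      = ((s - t (k - 1)) powr \<beta> - (s - t k) powr \<beta>) / Gamma (1 + \<beta>)"
      using omega_integral[OF b, of "t (k - 1)" "t k"] k by (auto simp: min_absorb1)
  qed auto
  also have "\<dots> = ((t n - t (k - 1)) powr (1 + \<beta>) - (t (n - 1) - t (k - 1)) powr (1 + \<beta>)
      - ((t n - t k) powr (1 + \<beta>) - (t (n - 1) - t k) powr (1 + \<beta>))) / Gamma (2 + \<beta>)"
    using powr_integral[OF b, of "t (k - 1)" "t (n - 1)" "t n"]
      powr_integral[OF b, of "t k" "t (n - 1)" "t n"] n k b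
    by (simp add: Gamma_plus_two set_integral_diff diff_divide_distrib)
  finally have eq: "(LINT s:{t (n - 1)..t n}|lebesgue. (LINT s':{t (k - 1)..min (t k) s}|lebesgue. omega \<beta> (s - s')))
    = \<dots>" .
  have shift: "x - t k + step t k = x - t (k - 1)" for x
    by (simp add: step_def)
  show ?thesis
    unfolding b_kernel_def Let_def diff_diff_cancel[OF k(3)] eq powr_slope_def shift
    by (simp add: diff_divide_distrib mult.commute)
qed

section \<open>Frequency representation of powers and the positive semidefinite cell form\<close>

text \<open>The weight \<open>w powr (- 1 - p)\<close> is chosen so that the integral scales like \<open>\<bar>x\<bar> powr p\<close>.\<close>

definition cos_density :: "real \<Rightarrow> real \<Rightarrow> real \<Rightarrow> real" where
  "cos_density p x w = indicator {0<..} w * ((1 - cos (w * x)) * w powr (- 1 - p))"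

lemma one_minus_cos_le: "1 - cos x \<le> x\<^sup>2 / 2" for x :: real
proof -
  have "(sin (x / 2))\<^sup>2 \<le> (x / 2)\<^sup>2"
    using abs_sin_x_le_abs_x[of "x / 2"] abs_le_square_iff by blast
  then show ?thesis
    using cos_double_sin[of "x / 2"] by (simp add: power2_eq_square)
qed

lemma cos_density_integrable:
  assumes p: "1 < p" "p < 2"
  shows "integrable lborel (cos_density p x)"
proof -
  \<comment> \<open>The majorant uses 1 - cos y \<le> y^2 / 2 near 0, where w^(1 - p) is integrable
    because p < 2, and 1 - cos y \<le> 2 on the tail.\<close>
  let ?g = "\<lambda>w. x\<^sup>2 / 2 * (indicator {0..1} w * w powr (1 - p)) + 2 * (indicator {1..} w * w powr (- 1 - p))"
  have 1: "(\<lambda>w. w powr (1 - p)) absolutely_integrable_on {0..1}"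
    using p by (intro nonnegative_absolutely_integrable_1 integrable_on_powr_from_0) auto
  have 2: "(\<lambda>w. w powr (- 1 - p)) absolutely_integrable_on {1..}"
    using p has_integral_powr_to_inf[of "- 1 - p" 1]
    by (intro nonnegative_absolutely_integrable_1) (auto simp: integrable_on_def)
  have 1: "integrable lborel (\<lambda>w. indicator {0..1} w * w powr (1 - p))"
    using 1 unfolding set_integrable_def by (subst (asm) integrable_completion) auto
  have 2: "integrable lborel (\<lambda>w. indicator {1..} w * w powr (- 1 - p))"
    using 2 unfolding set_integrable_def by (subst (asm) integrable_completion) auto
  show ?thesis
  proof (rule Bochner_Integration.integrable_bound)
    show "integrable lborel ?g"
      using 1 2 by (intro Bochner_Integration.integrable_add integrable_mult_right)
    show "AE w in lborel. norm (cos_density p x w) \<le> norm (?g w)"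
    proof (rule AE_I2)
      fix w :: real
      show "norm (cos_density p x w) \<le> norm (?g w)"
      proof (cases "0 < w")
        case pos: True
        have nn: "0 \<le> 1 - cos (w * x)" by simp
        show ?thesis
        proof (cases "w < 1")
          case True
          have "(1 - cos (w * x)) * w powr (- 1 - p) \<le> (w * x)\<^sup>2 / 2 * w powr (- 1 - p)"
            using one_minus_cos_le by (intro mult_right_mono) auto
          also have "\<dots> = x\<^sup>2 / 2 * (w powr 2 * w powr (- 1 - p))"
            using pos by (simp add: power_mult_distrib)
          also have "w powr 2 * w powr (- 1 - p) = w powr (1 - p)"
            by (simp add: powr_add[symmetric])
          finally show ?thesis
            using True pos nn by (simp add: cos_density_def abs_mult)
        next
          case False
          have "1 - cos (w * x) \<le> 2" using cos_ge_minus_one[of "w * x"] by linarith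
          then have "(1 - cos (w * x)) * w powr (- 1 - p) \<le> 2 * w powr (- 1 - p)"
            by (intro mult_right_mono) auto
          moreover have "norm (cos_density p x w) = (1 - cos (w * x)) * w powr (- 1 - p)"
            using pos nn by (simp add: cos_density_def abs_mult)
          moreover have "2 * w powr (- 1 - p) \<le> ?g w" "?g w \<le> norm (?g w)"
            using False by simp_all
          ultimately show ?thesis by linarith
        qed
      qed (simp add: cos_density_def)
    qed
    show "cos_density p x \<in> borel_measurable lborel"
      unfolding cos_density_def by measurable
  qed
qed

lemma cos_density_integral_scale:
  "integral\<^sup>L lborel (cos_density p x) = \<bar>x\<bar> powr p * integral\<^sup>L lborel (cos_density p 1)"
proof (cases "x = 0")
  case False
  define y where "y = \<bar>x\<bar>"
  have y: "y > 0" using False by (simp add: y_def)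
  have "cos_density p x = cos_density p y"
    by (auto simp: cos_density_def y_def abs_if)
  moreover have "integral\<^sup>L lborel (cos_density p 1) = y * (LINT w|lborel. cos_density p 1 (y * w))"
    using lborel_integral_real_affine[of y "cos_density p 1" 0] y by simp
  moreover have "cos_density p 1 (y * w) = y powr (- 1 - p) * cos_density p y w" for w
    using y by (auto simp: cos_density_def indicator_def powr_mult zero_less_mult_iff mult.commute)
  moreover have "y powr p * (y * y powr (- 1 - p)) = 1"
    using y powr_add[of y 1 "- 1 - p"] powr_add[of y p "- p"] by simp
  ultimately show ?thesis
    unfolding y_def[symmetric] by (simp add: mult.assoc[symmetric])
qed (simp add: cos_density_def[abs_def])

lemma cos_density_integral_pos:
  assumes p: "1 < p" "p < 2"
  shows "integral\<^sup>L lborel (cos_density p 1) > 0"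
proof -
  have nn: "cos_density p 1 w \<ge> 0" for w by (simp add: cos_density_def)
  have "integral\<^sup>L lborel (cos_density p 1) \<noteq> 0"
  proof
    assume "integral\<^sup>L lborel (cos_density p 1) = 0"
    then have "AE w in lborel. cos_density p 1 w = 0"
      using integral_nonneg_eq_0_iff_AE[OF cos_density_integrable[OF p]] nn by auto
    \<comment> \<open>A set of positive measure on which the density is positive: [1, 2] lies in (0,
      pi), where cos stays below 1.\<close>
    then have "AE w in lborel. w \<notin> {1..2::real}"
    proof eventually_elim
      case (elim w)
      show ?case
      proof
        assume a: "w \<in> {1..2}"
        then have "cos w = 1" using elim by (auto simp: cos_density_def)
        moreover have "cos w < cos 0"
          using a pi_gt3 by (intro cos_monotone_0_pi) auto
        ultimately show False by simp
      qed
    qed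
    then have "{1..2::real} \<in> null_sets lborel"
      by (subst AE_iff_null_sets) auto
    then have "emeasure lborel {1..2::real} = 0" by blast
    then show False by (subst (asm) emeasure_lborel_Icc) auto
  qed
  moreover have "integral\<^sup>L lborel (cos_density p 1) \<ge> 0"
    using nn by simp
  ultimately show ?thesis by linarith
qed

text \<open>Negative of the mixed second difference of \<open>\<bar>x - y\<bar> powr p\<close>: up to a positive factor the double
  integral of \<open>\<bar>x - y\<bar> powr (p - 2)\<close> over a product of two cells.\<close>

definition cell_form :: "real \<Rightarrow> (nat \<Rightarrow> real) \<Rightarrow> nat \<Rightarrow> nat \<Rightarrow> real" where
  "cell_form p t i j = \<bar>t i - t (j - 1)\<bar> powr p + \<bar>t (i - 1) - t j\<bar> powr p
     - \<bar>t i - t j\<bar> powr p - \<bar>t (i - 1) - t (j - 1)\<bar> powr p"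

lemma cell_form_pos_semidef:
  assumes p: "1 < p" "p < 2" and "finite I"
  shows "0 \<le> (\<Sum>i\<in>I. \<Sum>j\<in>I. v i * v j * cell_form p t i j)"
proof -
  define C where "C = integral\<^sup>L lborel (cos_density p 1)"
  have C: "C > 0" using cos_density_integral_pos[OF p] by (simp add: C_def)
  let ?d = "\<lambda>i j w. cos_density p (t i - t (j - 1)) w + cos_density p (t (i - 1) - t j) w
     - cos_density p (t i - t j) w - cos_density p (t (i - 1) - t (j - 1)) w"
  note int = cos_density_integrable[OF p]
  have cell: "C * cell_form p t i j = integral\<^sup>L lborel (?d i j)" for i j
    using int by (simp add: cell_form_def cos_density_integral_scale[of p, folded C_def] algebra_simps)
  \<comment> \<open>In the mixed second difference the ones cancel, and the addition theorem factors
    the cosines. The bracket is the real part of z_i times the conjugate of z_j, with z_i the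
    increment of exp (i w t) over cell i, so the double sum becomes a squared modulus.\<close>
  have d: "?d i j w = indicator {0<..} w * w powr (- 1 - p) *
      ((cos (w * t i) - cos (w * t (i - 1))) * (cos (w * t j) - cos (w * t (j - 1)))
     + (sin (w * t i) - sin (w * t (i - 1))) * (sin (w * t j) - sin (w * t (j - 1))))" for i j w
    by (simp add: cos_density_def right_diff_distrib cos_diff algebra_simps)
  have d_int: "integrable lborel (\<lambda>w. v i * v j * ?d i j w)" for i j
    using int by (intro integrable_mult_right Bochner_Integration.integrable_diff
        Bochner_Integration.integrable_add)
  have "C * (\<Sum>i\<in>I. \<Sum>j\<in>I. v i * v j * cell_form p t i j)
      = (\<Sum>i\<in>I. \<Sum>j\<in>I. v i * v j * (C * cell_form p t i j))"
    by (simp add: sum_distrib_left mult.left_commute)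
  also have "\<dots> = (\<Sum>i\<in>I. \<Sum>j\<in>I. v i * v j * integral\<^sup>L lborel (?d i j))"
    unfolding cell ..
  also have "\<dots> = (LINT w|lborel. (\<Sum>i\<in>I. \<Sum>j\<in>I. v i * v j * ?d i j w))"
    by (simp only: Bochner_Integration.integral_sum Bochner_Integration.integrable_sum
        integral_mult_right_zero d_int)
  also have "(\<lambda>w. \<Sum>i\<in>I. \<Sum>j\<in>I. v i * v j * ?d i j w) = (\<lambda>w. indicator {0<..} w * w powr (- 1 - p) *
     ((\<Sum>i\<in>I. v i * (cos (w * t i) - cos (w * t (i - 1))))\<^sup>2
      + (\<Sum>i\<in>I. v i * (sin (w * t i) - sin (w * t (i - 1))))\<^sup>2))"
  proof
    fix w
    let ?k = "indicator {0<..} w * w powr (- 1 - p)"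
    let ?c = "\<lambda>i. v i * (cos (w * t i) - cos (w * t (i - 1)))"
    let ?s = "\<lambda>i. v i * (sin (w * t i) - sin (w * t (i - 1)))"
    have "v i * v j * ?d i j w = ?k * (?c i * ?c j) + ?k * (?s i * ?s j)" for i j
      unfolding d by (simp add: algebra_simps)
    then have "(\<Sum>i\<in>I. \<Sum>j\<in>I. v i * v j * ?d i j w)
        = ?k * ((\<Sum>i\<in>I. \<Sum>j\<in>I. ?c i * ?c j) + (\<Sum>i\<in>I. \<Sum>j\<in>I. ?s i * ?s j))"
      by (simp only: sum.distrib sum_distrib_left distrib_left)
    then show "(\<Sum>i\<in>I. \<Sum>j\<in>I. v i * v j * ?d i j w) = ?k * ((\<Sum>i\<in>I. ?c i)\<^sup>2 + (\<Sum>i\<in>I. ?s i)\<^sup>2)"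
      by (simp only: power2_eq_square sum_product)
  qed
  also have "integral\<^sup>L lborel \<dots> \<ge> 0"
    by (intro Bochner_Integration.integral_nonneg) auto
  finally show ?thesis
    using C by (simp add: zero_le_mult_iff)
qed

section \<open>Signs of the kernel combinations in the remainder functional\<close>

lemma powr_slope_scale:
  assumes "0 < l" "0 < a" "0 \<le> x"
  shows "powr_slope \<beta> (a * l) (x * l) = l powr \<beta> * powr_slope \<beta> a x"
proof -
  have "(x * l + a * l) powr (1 + \<beta>) = l powr (1 + \<beta>) * (x + a) powr (1 + \<beta>)"
    using assms powr_mult[of "x + a" l "1 + \<beta>"] by (simp add: algebra_simps)
  moreover have "(x * l) powr (1 + \<beta>) = l powr (1 + \<beta>) * x powr (1 + \<beta>)"
    using assms powr_mult[of x l "1 + \<beta>"] by simp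
  moreover have "l powr (1 + \<beta>) = l * l powr \<beta>"
    using assms by (simp add: powr_add)
  ultimately show ?thesis
    using assms by (simp add: powr_slope_def field_simps)
qed

text \<open>Up to Gamma (2 + \<beta>) this is the coefficient touching the diagonal, for consecutive
  cells of lengths l, a, c: the terms are twice the diagonal kernel, the next kernel of the same
  level, and a kernel difference of the following level. Homogeneity of degree \<beta> - 1 in the
  lengths leaves only the ratios a / l and c / a.\<close>

lemma powr_slope_gap_nonneg:
  assumes b: "0 < \<beta>" "\<beta> < 1" and pos: "0 < l" "0 < a" "0 < c" and H: "H_fun \<beta> (a / l) \<le> c / a"
  shows "0 \<le> 2 * (a powr (1 + \<beta>) / a\<^sup>2) - (powr_slope \<beta> l a - powr_slope \<beta> l 0) / a
    - (slope_gap \<beta> a l c - slope_gap \<beta> a l 0) / c"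
proof -
  define \<rho> s where "\<rho> = a / l" and "s = c / a"
  have r: "0 < \<rho>" and s: "0 < s" using pos by (simp_all add: \<rho>_def s_def)
  have a: "a = \<rho> * l" and c: "c = (\<rho> * s) * l" using pos by (simp_all add: \<rho>_def s_def)
  have scale: "powr_slope \<beta> l (x * l) = l powr \<beta> * powr_slope \<beta> 1 x" if "0 \<le> x" for x
    using powr_slope_scale[of l 1 x \<beta>] pos that by simp
  have gap: "slope_gap \<beta> a l (x * l) = l powr \<beta> * slope_gap \<beta> \<rho> 1 x" if "0 \<le> x" for x
    unfolding slope_gap_def a
    using powr_slope_scale[of l \<rho> x \<beta>] scale[of "x + \<rho>"] pos r that
    by (simp add: algebra_simps)
  have "a powr (1 + \<beta>) / a\<^sup>2 = l powr \<beta> / l * (\<rho> powr \<beta> / \<rho>)"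
    using pos r by (simp add: a powr_mult powr_add power2_eq_square mult.commute)
  moreover have "powr_slope \<beta> l a - powr_slope \<beta> l 0 = l powr \<beta> * h_fun \<beta> \<rho>"
  proof -
    have "powr_slope \<beta> 1 0 = 1" using b by (simp add: powr_slope_def)
    then show ?thesis
      using scale[of \<rho>] scale[of 0] r by (simp add: a h_fun_powr_slope right_diff_distrib)
  qed
  then have "(powr_slope \<beta> l a - powr_slope \<beta> l 0) / a = l powr \<beta> / l * (h_fun \<beta> \<rho> / \<rho>)"
    by (simp add: a mult.commute)
  moreover have "(slope_gap \<beta> a l c - slope_gap \<beta> a l 0) / c = l powr \<beta> / l *
      (((\<rho> powr \<beta> * h_fun \<beta> s - h_fun \<beta> (\<rho> + \<rho> * s) + h_fun \<beta> \<rho>) / s) / \<rho>)"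
    using gap[of "\<rho> * s"] gap[of 0] r s slope_gap_h_fun[OF b(1) r s]
    by (simp add: c right_diff_distrib[symmetric] mult.commute)
  ultimately have "2 * (a powr (1 + \<beta>) / a\<^sup>2) - (powr_slope \<beta> l a - powr_slope \<beta> l 0) / a
    - (slope_gap \<beta> a l c - slope_gap \<beta> a l 0) / c = l powr \<beta> / l / \<rho> * (2 * \<rho> powr \<beta> - h_fun \<beta> \<rho>
      - (\<rho> powr \<beta> * h_fun \<beta> s - h_fun \<beta> (\<rho> + \<rho> * s) + h_fun \<beta> \<rho>) / s)"
    by (simp add: diff_divide_distrib right_diff_distrib mult_ac)
  moreover have "0 \<le> 2 * \<rho> powr \<beta> - h_fun \<beta> \<rho>
      - (\<rho> powr \<beta> * h_fun \<beta> s - h_fun \<beta> (\<rho> + \<rho> * s) + h_fun \<beta> \<rho>) / s"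
    using step_ratio_inequality[OF b r s] H by (simp add: \<rho>_def s_def)
  ultimately show ?thesis
    using pos r by simp
qed

lemma grid_mono:
  fixes t :: "nat \<Rightarrow> real"
  assumes "\<forall>k\<in>{1..N}. t (k - 1) < t k" "i \<le> j" "j \<le> N"
  shows "t i \<le> t j"
  using assms(2,3)
proof (induction j rule: dec_induct)
  case (step m)
  then show ?case using bspec[OF assms(1), of "Suc m"] by force
qed simp

text \<open>Both kernels belong to the first cell, so they are slopes of the same
  \<open>powr_slope\<close> over the two newest cells. Since 1 \<le> m, neither is a diagonal
  entry.\<close>

lemma b_tilde_first_antimono:
  assumes b: "0 < \<beta>" "\<beta> < 1" and t: "\<forall>k\<in>{1..N}. t (k - 1) < t k" and m: "1 \<le> m" "m + 2 \<le> N"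
  shows "b_tilde t \<beta> (m + 2) (m + 1) \<le> b_tilde t \<beta> (m + 1) m"
proof -
  have lt: "t 0 < t 1" "t m < t (m + 1)" "t (m + 1) < t (m + 2)"
    using t[THEN bspec, of 1] t[THEN bspec, of "m + 1"] t[THEN bspec, of "m + 2"] m by auto
  have le: "t 1 \<le> t m" "t 1 \<le> t (m + 1)" using grid_mono[OF t] m by auto
  let ?P = "\<lambda>n. powr_slope \<beta> (step t 1) (t n - t 1)"
  have "b_kernel t \<beta> (m + 2) (m + 1) = (?P (m + 2) - ?P (m + 1)) / step t (m + 2) / Gamma (2 + \<beta>)"
    using b_kernel_off_diag[OF b(1), of t "m + 2" 1] lt le by simp
  moreover have "b_kernel t \<beta> (m + 1) m = (?P (m + 1) - ?P m) / step t (m + 1) / Gamma (2 + \<beta>)"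
    using b_kernel_off_diag[OF b(1), of t "m + 1" 1] lt le by simp
  moreover have "(?P (m + 2) - ?P (m + 1)) / step t (m + 2) \<le> (?P (m + 1) - ?P m) / step t (m + 1)"
    using powr_slope_concave[OF b, of "step t 1" "t m - t 1" "t (m + 1) - t 1" "t (m + 2) - t 1"] lt le
    by (simp add: step_def)
  ultimately have "b_kernel t \<beta> (m + 2) (m + 1) \<le> b_kernel t \<beta> (m + 1) m"
    using b by (simp only:) (intro divide_right_mono, auto simp: Gamma_real_pos less_imp_le)
  then show ?thesis
    using m by (simp add: b_tilde_def)
qed

text \<open>For k < m all four kernels lie off the diagonal; subtracting neighbouring cells produces
  \<open>slope_gap\<close>, and subtracting levels compares its slopes over the two newest cells.
  For k = m the first kernel is the doubled diagonal entry, and the step-ratio condition takes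
  over.\<close>

lemma b_tilde_mixed_diff_nonneg:
  assumes b: "0 < \<beta>" "\<beta> < 1" and t: "\<forall>k\<in>{1..N}. t (k - 1) < t k" and k: "1 \<le> k" "k \<le> m" "m + 2 \<le> N"
    and H: "H_fun \<beta> (step_ratio t (m + 1)) \<le> step_ratio t (m + 2)"
  shows "0 \<le> b_tilde t \<beta> (m + 1) (m - k) - b_tilde t \<beta> (m + 1) (m + 1 - k)
    - b_tilde t \<beta> (m + 2) (m + 1 - k) + b_tilde t \<beta> (m + 2) (m + 2 - k)"
proof -
  have lt: "t (k - 1) < t k" "t k < t (k + 1)" "t m < t (m + 1)" "t (m + 1) < t (m + 2)"
    using t[THEN bspec, of k] t[THEN bspec, of "k + 1"] t[THEN bspec, of "m + 1"]
      t[THEN bspec, of "m + 2"] k by auto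
  have le: "t k \<le> t m" "t (k + 1) \<le> t (m + 1)" "t k \<le> t (m + 1)" using grid_mono[OF t] k by auto
  have G: "Gamma (2 + \<beta>) > 0" using b by (simp add: Gamma_real_pos)
  let ?a = "step t (k + 1)" and ?l = "step t k"
  have shift: "x - t k = x - t (k + 1) + ?a" for x by (simp add: step_def)
  have B: "b_kernel t \<beta> (m + 2) (m + 1 - k) - b_kernel t \<beta> (m + 2) (m + 2 - k)
      = (slope_gap \<beta> ?a ?l (t (m + 2) - t (k + 1)) - slope_gap \<beta> ?a ?l (t (m + 1) - t (k + 1)))
        / step t (m + 2) / Gamma (2 + \<beta>)"
    using b_kernel_off_diag[OF b(1), of t "m + 2" k] b_kernel_off_diag[OF b(1), of t "m + 2" "k + 1"] lt le k
    by (simp add: slope_gap_def shift diff_divide_distrib)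
  show ?thesis
  proof (cases "k = m")
    case True
    have "b_kernel t \<beta> (m + 1) 1 = (powr_slope \<beta> ?l ?a - powr_slope \<beta> ?l 0) / ?a / Gamma (2 + \<beta>)"
      using b_kernel_off_diag[OF b(1), of t "m + 1" k] lt le True by (simp add: step_def)
    moreover have "b_kernel t \<beta> (m + 1) 0 = ?a powr (1 + \<beta>) / ?a\<^sup>2 / Gamma (2 + \<beta>)"
      using b_kernel_diag[OF b(1), of t "m + 1"] lt True by simp
    moreover have "0 \<le> (2 * (?a powr (1 + \<beta>) / ?a\<^sup>2) - (powr_slope \<beta> ?l ?a - powr_slope \<beta> ?l 0) / ?a
      - (slope_gap \<beta> ?a ?l (step t (m + 2)) - slope_gap \<beta> ?a ?l 0) / step t (m + 2)) / Gamma (2 + \<beta>)"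
      using lt H True G by (intro divide_nonneg_pos powr_slope_gap_nonneg b)
        (auto simp: step_ratio_def step_def)
    ultimately show ?thesis
      using B True by (simp add: b_tilde_def step_def diff_divide_distrib)
  next
    case False
    then have km: "k + 1 \<le> m" using k by simp
    then have le': "t (k + 1) \<le> t m" using grid_mono[OF t] k by auto
    have "b_kernel t \<beta> (m + 1) (m - k) - b_kernel t \<beta> (m + 1) (m + 1 - k)
      = (slope_gap \<beta> ?a ?l (t (m + 1) - t (k + 1)) - slope_gap \<beta> ?a ?l (t m - t (k + 1)))
        / step t (m + 1) / Gamma (2 + \<beta>)"
      using b_kernel_off_diag[OF b(1), of t "m + 1" k] b_kernel_off_diag[OF b(1), of t "m + 1" "k + 1"] lt le k km le'
      by (simp add: slope_gap_def shift diff_divide_distrib)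
    moreover have "(slope_gap \<beta> ?a ?l (t (m + 2) - t (k + 1)) - slope_gap \<beta> ?a ?l (t (m + 1) - t (k + 1))) / step t (m + 2)
      \<le> (slope_gap \<beta> ?a ?l (t (m + 1) - t (k + 1)) - slope_gap \<beta> ?a ?l (t m - t (k + 1))) / step t (m + 1)"
      using slope_gap_concave[OF b, of ?a ?l "t m - t (k + 1)" "t (m + 1) - t (k + 1)" "t (m + 2) - t (k + 1)"] lt le le'
      by (simp add: step_def)
    ultimately have "b_kernel t \<beta> (m + 2) (m + 1 - k) - b_kernel t \<beta> (m + 2) (m + 2 - k)
      \<le> b_kernel t \<beta> (m + 1) (m - k) - b_kernel t \<beta> (m + 1) (m + 1 - k)"
      using G by (simp only: B) (intro divide_right_mono, auto)
    then show ?thesis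
      using km by (simp add: b_tilde_def)
  qed
qed

section \<open>Nonnegativity of the convolution form of the discrete Caputo derivative\<close>

lemma sum_square_symmetric:
  fixes F :: "nat \<Rightarrow> nat \<Rightarrow> real"
  assumes "\<And>i j. F i j = F j i"
  shows "2 * (\<Sum>i=1..n. F i i / 2 + (\<Sum>k=1..i-1. F i k)) = (\<Sum>i=1..n. \<Sum>j=1..n. F i j)"
proof (induction n)
  case (Suc n)
  have "(\<Sum>i=1..n. F i (Suc n)) = (\<Sum>i=1..n. F (Suc n) i)"
    by (intro sum.cong refl assms)
  with Suc show ?case by (simp add: sum.distrib)
qed simp

lemma cell_form_commute: "cell_form p t i j = cell_form p t j i"
  by (simp add: cell_form_def abs_minus_commute)

text \<open>The convolution sees only the cells k \<le> i. These entries form the lower triangle of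
  a symmetric form with half its diagonal, so the sum is half of the full form.\<close>

lemma L1plus_kernel_pos_semidef:
  assumes b: "0 < \<beta>" "\<beta> < 1" and t: "\<forall>k\<in>{1..N}. t (k - 1) < t k" and n: "n \<le> N"
  shows "0 \<le> (\<Sum>i=1..n. (\<Sum>k=1..i. b_kernel t \<beta> i (i - k) * u k) * u i)"
proof -
  \<comment> \<open>Absorbs the factors 1 / (\<open>step t i\<close> * \<open>step t k\<close>) of
    the kernel into the sequence.\<close>
  define v where "v k = u k / step t k" for k
  let ?F = "\<lambda>i j. v i * v j * cell_form (1 + \<beta>) t i j"
  have summand: "(\<Sum>k=1..i. b_kernel t \<beta> i (i - k) * u k) * u i
      = (?F i i / 2 + (\<Sum>k=1..i-1. ?F i k)) / Gamma (2 + \<beta>)" if i: "i \<in> {1..n}" for i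
  proof -
    have lt: "t (i - 1) < t i" using t i n by auto
    \<comment> \<open>The diagonal kernel integrates over the triangle below the diagonal of a
      square cell, hence the half.\<close>
    have "b_kernel t \<beta> i 0 * u i * u i = ?F i i / 2 / Gamma (2 + \<beta>)"
      using lt by (simp add: b_kernel_diag[OF b(1) lt] cell_form_def v_def power2_eq_square step_def abs_minus_commute)
    moreover have "b_kernel t \<beta> i (i - k) * u k * u i = ?F i k / Gamma (2 + \<beta>)" if k: "k \<in> {1..i - 1}" for k
    proof -
      have ltk: "t (k - 1) < t k" using t i n k by auto
      have le: "t k \<le> t (i - 1)" using i n k by (intro grid_mono[OF t]) auto
      have "cell_form (1 + \<beta>) t i k = step t k * (powr_slope \<beta> (step t k) (t i - t k)
          - powr_slope \<beta> (step t k) (t (i - 1) - t k))"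
      proof -
        have "step t k * powr_slope \<beta> (step t k) x = (x + step t k) powr (1 + \<beta>) - x powr (1 + \<beta>)" for x
          using ltk by (simp add: powr_slope_def step_def)
        then show ?thesis
          using lt ltk le by (simp add: cell_form_def step_def right_diff_distrib)
      qed
      moreover have "b_kernel t \<beta> i (i - k) = (powr_slope \<beta> (step t k) (t i - t k)
          - powr_slope \<beta> (step t k) (t (i - 1) - t k)) / step t i / Gamma (2 + \<beta>)"
        using k by (intro b_kernel_off_diag[OF b(1) lt ltk le]) auto
      ultimately show ?thesis
        using ltk by (simp add: v_def step_def)
    qed
    moreover have "(\<Sum>k=1..i. b_kernel t \<beta> i (i - k) * u k)
        = b_kernel t \<beta> i 0 * u i + (\<Sum>k=1..i-1. b_kernel t \<beta> i (i - k) * u k)"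
      using i by (cases i) auto
    ultimately show ?thesis
      by (simp add: sum_distrib_right distrib_right add_divide_distrib sum_divide_distrib)
  qed
  have "(\<Sum>i=1..n. (\<Sum>k=1..i. b_kernel t \<beta> i (i - k) * u k) * u i)
      = (\<Sum>i=1..n. ?F i i / 2 + (\<Sum>k=1..i-1. ?F i k)) / Gamma (2 + \<beta>)"
    by (simp only: sum_divide_distrib summand cong: sum.cong)
  also have "\<dots> = (\<Sum>i=1..n. \<Sum>j=1..n. ?F i j) / 2 / Gamma (2 + \<beta>)"
    by (subst sum_square_symmetric[symmetric]) (auto simp: cell_form_commute)
  also have "\<dots> \<ge> 0"
    using cell_form_pos_semidef[of "1 + \<beta>" "{1..n}" v t] b by (simp add: Gamma_real_pos less_imp_le)
  finally show ?thesis .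
qed

section \<open>The discrete gradient structure\<close>

lemma sum_by_parts:
  fixes f d :: "nat \<Rightarrow> real"
  shows "(\<Sum>k=1..m. (f (k + 1) - f k) * d k) + f 1 * d 0 = f (m + 1) * d m + (\<Sum>k=1..m. f k * (d (k - 1) - d k))"
  by (induction m) (auto simp: algebra_simps)

text \<open>In \<open>A (m + 1) - A m + R (m + 1)\<close> all kernels of level \<open>m\<close> cancel; the remaining differences of
  squares factor through \<open>u (m + 1)\<close>, and summation by parts recovers the convolution.\<close>

lemma discrete_gradient_structure:
  fixes B :: "nat \<Rightarrow> nat \<Rightarrow> real" and u :: "nat \<Rightarrow> real"
  assumes "1 \<le> m"
  shows "(1/2 * (\<Sum>k=1..m. (B (m + 1) (m - k) - B (m + 1) (m + 1 - k)) * (\<Sum>j=k+1..m+1. u j)\<^sup>2)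
        + 1/2 * B (m + 1) m * (\<Sum>j=1..m+1. u j)\<^sup>2)
     - (1/2 * (\<Sum>k=1..m-1. (B m (m - k - 1) - B m (m - k)) * (\<Sum>j=k+1..m. u j)\<^sup>2)
        + 1/2 * B m (m - 1) * (\<Sum>j=1..m. u j)\<^sup>2)
     + (1/2 * (\<Sum>k=1..m-1. (B m (m - 1 - k) - B m (m - k) - B (m + 1) (m - k) + B (m + 1) (m + 1 - k))
            * (\<Sum>j=k+1..m. u j)\<^sup>2)
        + 1/2 * (B m (m - 1) - B (m + 1) m) * (\<Sum>j=1..m. u j)\<^sup>2)
     = (B (m + 1) 0 / 2 * u (m + 1) + (\<Sum>k=1..m. B (m + 1) (m + 1 - k) * u k)) * u (m + 1)"
proof -
  define V where "V k = (\<Sum>j=k+1..m. u j)" for k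
  define f where "f k = B (m + 1) (m + 1 - k)" for k
  define w where "w = u (m + 1)"
  have U: "(\<Sum>j=k+1..m+1. u j) = V k + w" if "k \<le> m" for k
    using that by (simp add: V_def w_def)
  have Vm: "V m = 0" by (simp add: V_def)
  have Vstep: "V (k - 1) - V k = u k" if "k \<in> {1..m}" for k
    using that sum.atLeast_Suc_atMost[of k m u] by (simp add: V_def)
  have f1: "B (m + 1) (m - k) = f (k + 1)" for k by (simp add: f_def)
  \<comment> \<open>The added term k = m vanishes because V m is an empty sum; now the range agrees
    with that of the newest level.\<close>
  have S0: "(\<Sum>k=1..m-1. (f (k + 1) - f k) * (V k)\<^sup>2) = (\<Sum>k=1..m. (f (k + 1) - f k) * (V k)\<^sup>2)"
    using assms Vm by (cases m) auto
  have S1: "(\<Sum>k=1..m. (B (m + 1) (m - k) - B (m + 1) (m + 1 - k)) * (\<Sum>j=k+1..m+1. u j)\<^sup>2)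
      = (\<Sum>k=1..m. (f (k + 1) - f k) * (V k + w)\<^sup>2)"
    by (intro sum.cong refl) (simp only: U f1 f_def[symmetric] atLeastAtMost_iff)
  have S2: "(\<Sum>k=1..m-1. (B m (m - 1 - k) - B m (m - k) - B (m + 1) (m - k) + B (m + 1) (m + 1 - k))
            * (\<Sum>j=k+1..m. u j)\<^sup>2)
      = (\<Sum>k=1..m-1. (B m (m - k - 1) - B m (m - k)) * (\<Sum>j=k+1..m. u j)\<^sup>2)
        - (\<Sum>k=1..m-1. (f (k + 1) - f k) * (V k)\<^sup>2)"
    unfolding sum_subtractf[symmetric]
    by (intro sum.cong refl) (simp add: V_def f1[symmetric] f_def algebra_simps diff_commute)
  have E: "(\<Sum>j=1..m+1. u j) = V 0 + w" "(\<Sum>j=1..m. u j) = V 0" "B (m + 1) m = f 1"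
    using U[of 0] by (simp_all add: V_def f_def)
  have "(\<Sum>k=1..m. (f (k + 1) - f k) * (V k + w)\<^sup>2) - (\<Sum>k=1..m. (f (k + 1) - f k) * (V k)\<^sup>2)
      + f 1 * ((V 0 + w)\<^sup>2 - (V 0)\<^sup>2)
    = w * ((\<Sum>k=1..m. (f (k + 1) - f k) * (2 * V k + w)) + f 1 * (2 * V 0 + w))"
    unfolding sum_subtractf[symmetric] distrib_left sum_distrib_left
    by (intro arg_cong2[where f = "(+)"] sum.cong refl) (simp_all add: power2_eq_square algebra_simps)
  \<comment> \<open>Abel summation with d k = 2 * V k + w moves the differences from the kernels to
    the partial sums: d (k - 1) - d k is 2 * u k, and d m is w.\<close>
  also have "\<dots> = w * (f (m + 1) * (2 * V m + w) + (\<Sum>k=1..m. f k * ((2 * V (k - 1) + w) - (2 * V k + w))))"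
    by (simp only: sum_by_parts[where f = f and m = m and d = "\<lambda>k. 2 * V k + w"])
  also have "(\<Sum>k=1..m. f k * ((2 * V (k - 1) + w) - (2 * V k + w))) = 2 * (\<Sum>k=1..m. f k * u k)"
    unfolding sum_distrib_left by (intro sum.cong refl) (simp add: Vstep[symmetric])
  finally have main: "(\<Sum>k=1..m. (f (k + 1) - f k) * (V k + w)\<^sup>2) - (\<Sum>k=1..m. (f (k + 1) - f k) * (V k)\<^sup>2)
      + f 1 * ((V 0 + w)\<^sup>2 - (V 0)\<^sup>2) = w * (f (m + 1) * w + 2 * (\<Sum>k=1..m. f k * u k))"
    by (simp add: Vm)
  have halves: "1/2 * X1 + 1/2 * f 1 * (V 0 + w)\<^sup>2 - (1/2 * P + 1/2 * q * (V 0)\<^sup>2)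
      + (1/2 * (P - X0) + 1/2 * (q - f 1) * (V 0)\<^sup>2)
      = (X1 - X0 + f 1 * ((V 0 + w)\<^sup>2 - (V 0)\<^sup>2)) / 2" for X1 X0 P q
    by (simp add: field_simps)
  show ?thesis
    unfolding S1 S2 E S0 w_def[symmetric] halves main by (simp add: f_def algebra_simps)
qed

section \<open>Periodic functions and integration by parts\<close>

lemma C_k_continuous: "C_k k f \<Longrightarrow> continuous_on UNIV f"
  by (cases k) auto

lemma C_k_SucD: "C_k (Suc k) f \<Longrightarrow> C_k k f"
  by (induction k arbitrary: f) (auto intro: C_k_continuous)

lemma C_k_deriv:
  assumes "C_k (Suc k) f" "i \<in> Basis"
  shows "((\<lambda>h. f (x + h *\<^sub>R i)) has_real_derivative partial_deriv i f x) (at 0)"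
  using assms unfolding partial_deriv_def
  by (simp add: DERIV_deriv_iff_real_differentiable)

lemma partial_deriv_eqI:
  "((\<lambda>h. f (x + h *\<^sub>R i)) has_real_derivative D) (at 0) \<Longrightarrow> partial_deriv i f x = D"
  unfolding partial_deriv_def by (rule DERIV_imp_deriv)

lemma partial_deriv_add:
  assumes "C_k (Suc k) f" "C_k (Suc k) g" "i \<in> Basis"
  shows "partial_deriv i (\<lambda>x. f x + g x) = (\<lambda>x. partial_deriv i f x + partial_deriv i g x)"
  using assms by (intro ext partial_deriv_eqI derivative_intros C_k_deriv)

lemma partial_deriv_cmult:
  assumes "C_k (Suc k) f" "i \<in> Basis"
  shows "partial_deriv i (\<lambda>x. c * f x) = (\<lambda>x. c * partial_deriv i f x)"
  using assms by (intro ext partial_deriv_eqI DERIV_cmult C_k_deriv)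

lemma partial_deriv_mult:
  assumes "C_k (Suc k) f" "C_k (Suc k) g" "i \<in> Basis"
  shows "partial_deriv i (\<lambda>x. f x * g x) = (\<lambda>x. partial_deriv i f x * g x + f x * partial_deriv i g x)"
  using DERIV_mult[OF C_k_deriv[OF assms(1,3)] C_k_deriv[OF assms(2,3)]]
  by (intro ext partial_deriv_eqI) (simp add: algebra_simps)

lemma C_k_const: "C_k k (\<lambda>x. c)"
  by (induction k arbitrary: c) (auto simp: partial_deriv_def[abs_def])

lemma C_k_add: "C_k k f \<Longrightarrow> C_k k g \<Longrightarrow> C_k k (\<lambda>x. f x + g x)"
proof (induction k arbitrary: f g)
  case (Suc k)
  have "(\<lambda>h. f (x + h *\<^sub>R i) + g (x + h *\<^sub>R i)) differentiable (at 0)" if "i \<in> Basis" for x i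
    using Suc.prems that by (intro differentiable_add) auto
  then show ?case
    using Suc by (auto simp: partial_deriv_add[OF Suc.prems] intro!: continuous_intros)
qed (auto intro: continuous_intros)

lemma C_k_cmult: "C_k k f \<Longrightarrow> C_k k (\<lambda>x. c * f x)"
proof (induction k arbitrary: f)
  case (Suc k)
  have "(\<lambda>h. c * f (x + h *\<^sub>R i)) differentiable (at 0)" if "i \<in> Basis" for x i
    using Suc.prems that by (intro differentiable_mult) auto
  then show ?case
    using Suc by (auto simp: partial_deriv_cmult[OF Suc.prems] intro!: continuous_intros)
qed (auto intro: continuous_intros)

lemma C_k_sum: "(\<And>i. i \<in> A \<Longrightarrow> C_k k (f i)) \<Longrightarrow> C_k k (\<lambda>x. \<Sum>i\<in>A. f i x)"
  by (induction A rule: infinite_finite_induct) (auto intro: C_k_const C_k_add)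

lemma C_1_mult:
  assumes "C_k 1 f" "C_k 1 g"
  shows "C_k 1 (\<lambda>x. f x * g x)"
proof -
  have "(\<lambda>h. f (x + h *\<^sub>R i) * g (x + h *\<^sub>R i)) differentiable (at 0)" if "i \<in> Basis" for x i
    using assms that by (intro differentiable_mult) auto
  then show ?thesis
    using assms partial_deriv_mult[of 0 f g]
    by (auto intro!: continuous_intros)
qed

lemma partial_deriv_C_k: "C_k (Suc k) f \<Longrightarrow> i \<in> Basis \<Longrightarrow> C_k k (partial_deriv i f)"
  by simp

lemma laplacian_C_k: "C_k (Suc (Suc k)) f \<Longrightarrow> C_k k (laplacian f)"
  unfolding laplacian_def[abs_def] by (intro C_k_sum partial_deriv_C_k)

lemma one_plus_lap_C_k:
  assumes "C_k (Suc (Suc k)) f"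
  shows "C_k k (one_plus_lap f)"
  unfolding one_plus_lap_def[abs_def]
  by (intro C_k_add laplacian_C_k assms C_k_SucD[OF C_k_SucD[OF assms]])

lemma SH_op_C_k: "C_k (k + 4) f \<Longrightarrow> C_k k (SH_op f)"
  unfolding SH_op_def by (intro one_plus_lap_C_k) (simp add: numeral_eq_Suc)

text \<open>\<open>partial_deriv\<close> is built on \<open>deriv\<close>, which carries no
  information where the derivative fails to exist; linearity therefore needs the smoothness
  class.\<close>

lemma one_plus_lap_lincomb:
  assumes "C_k 2 f" "C_k 2 g"
  shows "one_plus_lap (\<lambda>x. c * f x + d * g x) = (\<lambda>x. c * one_plus_lap f x + d * one_plus_lap g x)"
proof -
  have f: "C_k (Suc (Suc 0)) f" "C_k (Suc (Suc 0)) g"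
    using assms by (simp_all add: numeral_eq_Suc del: C_k.simps)
  have "partial_deriv i (partial_deriv i (\<lambda>x. c * f x + d * g x))
     = (\<lambda>x. c * partial_deriv i (partial_deriv i f) x + d * partial_deriv i (partial_deriv i g) x)"
    if i: "i \<in> Basis" for i
    by (simp del: C_k.simps add: i f C_k_cmult partial_deriv_C_k
        partial_deriv_add[of "Suc 0"] partial_deriv_cmult[of "Suc 0"]
        partial_deriv_add[of 0] partial_deriv_cmult[of 0])
  then show ?thesis
    by (auto simp: one_plus_lap_def laplacian_def sum.distrib sum_distrib_left algebra_simps)
qed

lemma SH_op_lincomb:
  assumes "C_k 4 f" "C_k 4 g"
  shows "SH_op (\<lambda>x. c * f x + d * g x) = (\<lambda>x. c * SH_op f x + d * SH_op g x)"
proof -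
  have 4: "C_k (Suc (Suc 2)) f" "C_k (Suc (Suc 2)) g"
    using assms by (simp_all add: numeral_eq_Suc del: C_k.simps)
  show ?thesis
    unfolding SH_op_def using 4[THEN C_k_SucD, THEN C_k_SucD] 4[THEN one_plus_lap_C_k]
    by (simp only: one_plus_lap_lincomb)
qed

lemma box_periodic_mult: "box_periodic a b f \<Longrightarrow> box_periodic a b g \<Longrightarrow> box_periodic a b (\<lambda>x. f x * g x)"
  by (simp add: box_periodic_def)

lemma box_periodic_partial_deriv:
  assumes "box_periodic a b f"
  shows "box_periodic a b (partial_deriv i f)"
  unfolding box_periodic_def partial_deriv_def
proof (intro ballI allI)
  fix j x assume "j \<in> (Basis :: 'a set)"
  then have "f (x + ((b - a) \<bullet> j) *\<^sub>R j + h *\<^sub>R i) = f (x + h *\<^sub>R i)" for h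
    using assms[unfolded box_periodic_def, rule_format, of j "x + h *\<^sub>R i"]
    by (simp add: ac_simps)
  then show "deriv (\<lambda>h. f (x + ((b - a) \<bullet> j) *\<^sub>R j + h *\<^sub>R i)) 0 = deriv (\<lambda>h. f (x + h *\<^sub>R i)) 0"
    by simp
qed

lemma box_periodic_one_plus_lap: "box_periodic a b f \<Longrightarrow> box_periodic a b (one_plus_lap f)"
  using box_periodic_partial_deriv[OF box_periodic_partial_deriv, of a b f]
  unfolding one_plus_lap_def[abs_def] laplacian_def[abs_def] by (simp add: box_periodic_def)

text \<open>The shifted box is cut at the hyperplane where coordinate i equals b \<bullet> i. The
  part beyond it is a slab of thickness s, which one period carries back to the slab of the original
  box that the shift has vacated.\<close>

lemma integral_periodic_shift:
  fixes f :: "'a::euclidean_space \<Rightarrow> real"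
  assumes per: "box_periodic a b f" and cont: "continuous_on UNIV f"
    and i: "i \<in> Basis" and s: "0 \<le> s" "s \<le> (b - a) \<bullet> i"
  shows "integral (cbox a b) (\<lambda>x. f (x + s *\<^sub>R i)) = integral (cbox a b) f"
proof -
  define L where "L = (b - a) \<bullet> i"
  define c where "c = a \<bullet> i + s"
  define b' where "b' = b - (L - s) *\<^sub>R i"
  have int: "f integrable_on cbox u v" for u v
    by (intro integrable_continuous continuous_on_subset[OF cont]) auto
  have inner: "i \<bullet> j = (if i = j then 1 else 0)" if "j \<in> Basis" for j
    using i that by (simp add: inner_Basis)
  have A: "cbox a b \<inter> {x. x \<bullet> i \<le> c} = cbox a b'"
  proof (rule set_eqI)
    fix x
    have "x \<in> cbox a b \<inter> {x. x \<bullet> i \<le> c} \<longleftrightarrow>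
        (\<forall>j\<in>Basis. a \<bullet> j \<le> x \<bullet> j \<and> x \<bullet> j \<le> b \<bullet> j \<and> (j = i \<longrightarrow> x \<bullet> j \<le> c))"
      using i by (auto simp: mem_box)
    also have "\<dots> \<longleftrightarrow> x \<in> cbox a b'"
      unfolding mem_box using s
      by (intro ball_cong refl) (auto simp: b'_def c_def L_def inner_diff_left inner)
    finally show "x \<in> cbox a b \<inter> {x. x \<bullet> i \<le> c} \<longleftrightarrow> x \<in> cbox a b'" .
  qed
  have B: "cbox (a + s *\<^sub>R i) (b + s *\<^sub>R i) \<inter> {x. b \<bullet> i \<le> x \<bullet> i} = cbox (a + L *\<^sub>R i) (b' + L *\<^sub>R i)"
  proof (rule set_eqI)
    fix x
    have "x \<in> cbox (a + s *\<^sub>R i) (b + s *\<^sub>R i) \<inter> {x. b \<bullet> i \<le> x \<bullet> i} \<longleftrightarrow>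
        (\<forall>j\<in>Basis. (a + s *\<^sub>R i) \<bullet> j \<le> x \<bullet> j \<and> x \<bullet> j \<le> (b + s *\<^sub>R i) \<bullet> j \<and> (j = i \<longrightarrow> b \<bullet> i \<le> x \<bullet> j))"
      using i by (auto simp: mem_box)
    also have "\<dots> \<longleftrightarrow> x \<in> cbox (a + L *\<^sub>R i) (b' + L *\<^sub>R i)"
      unfolding mem_box using s
      by (intro ball_cong refl) (auto simp: b'_def L_def inner_diff_left inner_add_left inner)
    finally show "x \<in> cbox (a + s *\<^sub>R i) (b + s *\<^sub>R i) \<inter> {x. b \<bullet> i \<le> x \<bullet> i}
        \<longleftrightarrow> x \<in> cbox (a + L *\<^sub>R i) (b' + L *\<^sub>R i)" .
  qed
  have C: "cbox (a + s *\<^sub>R i) (b + s *\<^sub>R i) \<inter> {x. x \<bullet> i \<le> b \<bullet> i} = cbox a b \<inter> {x. c \<le> x \<bullet> i}"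
  proof (rule set_eqI)
    fix x
    have "x \<in> cbox (a + s *\<^sub>R i) (b + s *\<^sub>R i) \<inter> {x. x \<bullet> i \<le> b \<bullet> i} \<longleftrightarrow>
        (\<forall>j\<in>Basis. (a + s *\<^sub>R i) \<bullet> j \<le> x \<bullet> j \<and> x \<bullet> j \<le> (b + s *\<^sub>R i) \<bullet> j \<and> (j = i \<longrightarrow> x \<bullet> j \<le> b \<bullet> i))"
      using i by (auto simp: mem_box)
    also have "\<dots> \<longleftrightarrow> (\<forall>j\<in>Basis. a \<bullet> j \<le> x \<bullet> j \<and> x \<bullet> j \<le> b \<bullet> j \<and> (j = i \<longrightarrow> c \<le> x \<bullet> j))"
      using s by (intro ball_cong refl) (auto simp: c_def inner_add_left inner)
    also have "\<dots> \<longleftrightarrow> x \<in> cbox a b \<inter> {x. c \<le> x \<bullet> i}"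
      using i by (auto simp: mem_box)
    finally show "x \<in> cbox (a + s *\<^sub>R i) (b + s *\<^sub>R i) \<inter> {x. x \<bullet> i \<le> b \<bullet> i}
        \<longleftrightarrow> x \<in> cbox a b \<inter> {x. c \<le> x \<bullet> i}" .
  qed
  have shift: "integral (cbox u v) (\<lambda>x. f (x + w)) = integral (cbox (u + w) (v + w)) f" for u v w
    using integral_shift_cbox_plus[of u v f w] by (simp add: o_def add.commute)
  have "integral (cbox a b) (\<lambda>x. f (x + s *\<^sub>R i))
      = integral (cbox a b \<inter> {x. c \<le> x \<bullet> i}) f + integral (cbox (a + L *\<^sub>R i) (b' + L *\<^sub>R i)) f"
    unfolding shift using integral_split[OF int i, of "a + s *\<^sub>R i" "b + s *\<^sub>R i" "b \<bullet> i"] B C by simp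
  also have "integral (cbox (a + L *\<^sub>R i) (b' + L *\<^sub>R i)) f = integral (cbox a b') f"
    using per i by (simp add: shift[symmetric] box_periodic_def L_def)
  also have "integral (cbox a b \<inter> {x. c \<le> x \<bullet> i}) f + integral (cbox a b') f = integral (cbox a b) f"
    using integral_split[OF int i, of a b c] A by simp
  finally show ?thesis .
qed

text \<open>Averaging over shifts replaces slicing the box along axis i: along one period the
  derivative integrates to 0 from every starting point x, while after exchanging the integrals each
  shift contributes the same integral over the box.\<close>

lemma integral_partial_deriv_periodic:
  fixes f :: "'a::euclidean_space \<Rightarrow> real"
  assumes per: "box_periodic a b f" and C: "C_k 1 f" and i: "i \<in> Basis" and ab: "a \<bullet> i < b \<bullet> i"
  shows "integral (cbox a b) (partial_deriv i f) = 0"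
proof -
  define L where "L = (b - a) \<bullet> i"
  let ?p = "partial_deriv i f"
  have L: "L > 0" using ab by (simp add: L_def inner_diff_left)
  have C': "C_k (Suc 0) f" using C by simp
  have cont: "continuous_on UNIV ?p" using C i by simp
  have line: "integral (cbox 0 L) (\<lambda>s. ?p (x + s *\<^sub>R i)) = 0" for x
  proof -
    have "((\<lambda>s. f (x + s *\<^sub>R i)) has_real_derivative ?p (x + s *\<^sub>R i)) (at s)" for s
    proof -
      have "((\<lambda>h. f (x + (h + s) *\<^sub>R i)) has_real_derivative ?p (x + s *\<^sub>R i)) (at 0)"
        using C_k_deriv[OF C' i, of "x + s *\<^sub>R i"] by (simp add: algebra_simps)
      then show ?thesis
        using DERIV_shift[of "\<lambda>s. f (x + s *\<^sub>R i)" _ 0 s] by simp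
    qed
    then have "((\<lambda>s. ?p (x + s *\<^sub>R i)) has_integral f (x + L *\<^sub>R i) - f (x + 0 *\<^sub>R i)) {0..L}"
      using L by (intro fundamental_theorem_of_calculus)
        (auto simp: has_real_derivative_iff_has_vector_derivative intro: has_vector_derivative_at_within)
    then show ?thesis
      using per i by (simp add: integral_unique box_periodic_def L_def)
  qed
  have "0 = integral (cbox a b) (\<lambda>x. integral (cbox 0 L) (\<lambda>s. ?p (x + s *\<^sub>R i)))"
    by (simp only: line Henstock_Kurzweil_Integration.integral_0)
  also have "\<dots> = integral (cbox 0 L) (\<lambda>s. integral (cbox a b) (\<lambda>x. ?p (x + s *\<^sub>R i)))"
    by (intro integral_swap_continuous)
      (auto intro!: continuous_intros continuous_on_compose2[OF cont] simp: case_prod_unfold)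
  also have "\<dots> = integral (cbox 0 L) (\<lambda>s. integral (cbox a b) ?p)"
    using i cont box_periodic_partial_deriv[OF per]
    by (intro Henstock_Kurzweil_Integration.integral_cong integral_periodic_shift) (auto simp: L_def)
  also have "\<dots> = L * integral (cbox a b) ?p"
    using L by simp
  finally show ?thesis using L by simp
qed

lemma integral_by_parts_periodic:
  fixes u v :: "'a::euclidean_space \<Rightarrow> real"
  assumes "box_periodic a b u" "box_periodic a b v" "C_k 1 u" "C_k 1 v" "i \<in> Basis" "a \<bullet> i < b \<bullet> i"
  shows "integral (cbox a b) (\<lambda>x. u x * partial_deriv i v x)
    = - integral (cbox a b) (\<lambda>x. partial_deriv i u x * v x)"
proof -
  have c: "continuous_on UNIV u" "continuous_on UNIV v"
    "continuous_on UNIV (partial_deriv i u)" "continuous_on UNIV (partial_deriv i v)"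
    using assms by auto
  have "0 = integral (cbox a b) (partial_deriv i (\<lambda>x. u x * v x))"
    using assms by (intro integral_partial_deriv_periodic[symmetric] box_periodic_mult C_1_mult)
  also have "\<dots> = integral (cbox a b) (\<lambda>x. partial_deriv i u x * v x + u x * partial_deriv i v x)"
    using assms by (subst partial_deriv_mult[of 0]) auto
  also have "\<dots> = integral (cbox a b) (\<lambda>x. partial_deriv i u x * v x) + integral (cbox a b) (\<lambda>x. u x * partial_deriv i v x)"
    using c by (intro Henstock_Kurzweil_Integration.integral_add integrable_continuous continuous_intros)
      (auto intro: continuous_on_subset)
  finally show ?thesis by simp
qed

lemma laplacian_symmetric:
  fixes u v :: "'a::euclidean_space \<Rightarrow> real"
  assumes ab: "\<forall>i\<in>Basis. a \<bullet> i < b \<bullet> i"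
    and per: "box_periodic a b u" "box_periodic a b v" and C: "C_k 2 u" "C_k 2 v"
  shows "integral (cbox a b) (\<lambda>x. u x * laplacian v x) = integral (cbox a b) (\<lambda>x. laplacian u x * v x)"
proof -
  have C2: "C_k (Suc 1) u" "C_k (Suc 1) v"
    using C by (simp_all add: numeral_eq_Suc del: C_k.simps)
  have cont: "continuous_on UNIV w" if "C_k 1 w" for w :: "'a \<Rightarrow> real"
    using that by (rule C_k_continuous)
  have C1: "C_k 1 u" "C_k 1 v" "i \<in> Basis \<Longrightarrow> C_k 1 (partial_deriv i u)"
    "i \<in> Basis \<Longrightarrow> C_k 1 (partial_deriv i v)" for i
    using C2 by (auto intro: C_k_SucD simp del: C_k.simps intro!: partial_deriv_C_k)
  have C0: "continuous_on UNIV (partial_deriv i (partial_deriv i w))"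
    if "C_k (Suc 1) w" "i \<in> Basis" for w :: "'a \<Rightarrow> real" and i
    using that by simp
  have "integral (cbox a b) (\<lambda>x. u x * laplacian v x)
      = (\<Sum>i\<in>Basis. integral (cbox a b) (\<lambda>x. u x * partial_deriv i (partial_deriv i v) x))"
    unfolding laplacian_def sum_distrib_left
    using C0[OF C2(2)] cont[OF C1(1)]
    by (intro Henstock_Kurzweil_Integration.integral_sum integrable_continuous continuous_intros)
      (auto intro: continuous_on_subset)
  also have "\<dots> = (\<Sum>i\<in>Basis. integral (cbox a b) (\<lambda>x. partial_deriv i (partial_deriv i u) x * v x))"
  proof (intro sum.cong refl)
    fix i :: 'a assume i: "i \<in> Basis"
    have "integral (cbox a b) (\<lambda>x. u x * partial_deriv i (partial_deriv i v) x)
        = - integral (cbox a b) (\<lambda>x. partial_deriv i u x * partial_deriv i v x)"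
      using i ab per C1 by (intro integral_by_parts_periodic box_periodic_partial_deriv) auto
    also have "\<dots> = integral (cbox a b) (\<lambda>x. partial_deriv i (partial_deriv i u) x * v x)"
      using i ab per C1 by (subst integral_by_parts_periodic) (auto intro: box_periodic_partial_deriv simp del: C_k.simps)
    finally show "integral (cbox a b) (\<lambda>x. u x * partial_deriv i (partial_deriv i v) x)
        = integral (cbox a b) (\<lambda>x. partial_deriv i (partial_deriv i u) x * v x)" .
  qed
  also have "\<dots> = integral (cbox a b) (\<lambda>x. laplacian u x * v x)"
    unfolding laplacian_def sum_distrib_right
    using C0[OF C2(1)] cont[OF C1(2)]
    by (intro Henstock_Kurzweil_Integration.integral_sum[symmetric] integrable_continuous continuous_intros)
      (auto intro: continuous_on_subset)
  finally show ?thesis .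
qed

lemma one_plus_lap_symmetric:
  fixes u v :: "'a::euclidean_space \<Rightarrow> real"
  assumes ab: "\<forall>i\<in>Basis. a \<bullet> i < b \<bullet> i"
    and per: "box_periodic a b u" "box_periodic a b v" and C: "C_k 2 u" "C_k 2 v"
  shows "integral (cbox a b) (\<lambda>x. u x * one_plus_lap v x) = integral (cbox a b) (\<lambda>x. one_plus_lap u x * v x)"
proof -
  have C2: "C_k (Suc (Suc 0)) u" "C_k (Suc (Suc 0)) v"
    using C by (simp_all add: numeral_eq_Suc del: C_k.simps)
  have c: "continuous_on (cbox a b) w" if "C_k k w" for w :: "'a \<Rightarrow> real" and k
    using C_k_continuous[OF that] continuous_on_subset by blast
  note int = integrable_continuous[OF continuous_on_mult]
  have "integral (cbox a b) (\<lambda>x. u x * one_plus_lap v x)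
      = integral (cbox a b) (\<lambda>x. u x * v x) + integral (cbox a b) (\<lambda>x. u x * laplacian v x)"
    unfolding one_plus_lap_def distrib_left
    by (intro Henstock_Kurzweil_Integration.integral_add int c[OF C(1)] c[OF C(2)] c[OF laplacian_C_k[OF C2(2)]])
  also have "\<dots> = integral (cbox a b) (\<lambda>x. u x * v x) + integral (cbox a b) (\<lambda>x. laplacian u x * v x)"
    by (simp add: laplacian_symmetric[OF ab per C])
  also have "\<dots> = integral (cbox a b) (\<lambda>x. one_plus_lap u x * v x)"
    unfolding one_plus_lap_def distrib_right
    by (intro Henstock_Kurzweil_Integration.integral_add[symmetric] int c[OF C(1)] c[OF C(2)] c[OF laplacian_C_k[OF C2(1)]])
  finally show ?thesis .
qed

text \<open>The factors 1 + Delta are moved across one at a time, so each move asks for only two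
  continuous derivatives of either function.\<close>

lemma SH_op_symmetric:
  fixes u v :: "'a::euclidean_space \<Rightarrow> real"
  assumes ab: "\<forall>i\<in>Basis. a \<bullet> i < b \<bullet> i"
    and per: "box_periodic a b u" "box_periodic a b v" and C: "C_k 4 u" "C_k 4 v"
  shows "integral (cbox a b) (\<lambda>x. u x * SH_op v x) = integral (cbox a b) (\<lambda>x. SH_op u x * v x)"
proof -
  have 4: "C_k (Suc (Suc 2)) u" "C_k (Suc (Suc 2)) v"
    using C by (simp_all add: numeral_eq_Suc del: C_k.simps)
  note C2 = 4[THEN C_k_SucD, THEN C_k_SucD] and L2 = 4[THEN one_plus_lap_C_k]
    and perL = per[THEN box_periodic_one_plus_lap]
  show ?thesis
    unfolding SH_op_def
    using one_plus_lap_symmetric[OF ab per(1) perL(2) C2(1) L2(2)]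
      one_plus_lap_symmetric[OF ab perL(1) per(2) L2(1) C2(2)] by simp
qed

section \<open>Lebesgue integrals over the open box as gauge integrals over the closed box\<close>

lemma continuous_on_set_integrable_box:
  fixes f :: "'a::euclidean_space \<Rightarrow> real"
  assumes "continuous_on UNIV f"
  shows "set_integrable lebesgue (box a b) f"
  using absolutely_integrable_continuous[of a b f] assms
  by (meson box_subset_cbox continuous_on_subset set_integrable_subset subset_UNIV lmeasurable_box fmeasurableD)

lemma set_integral_box_eq_integral:
  fixes f :: "'a::euclidean_space \<Rightarrow> real"
  assumes "continuous_on UNIV f"
  shows "(LINT x:box a b|lebesgue. f x) = integral (cbox a b) f"
  using set_lebesgue_integral_eq_integral(2)[OF continuous_on_set_integrable_box[OF assms]]
  by (simp add: integral_open_interval)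

section \<open>Energy identities\<close>

lemma L2_norm_square:
  fixes f :: "'a::euclidean_space \<Rightarrow> real"
  assumes "continuous_on UNIV f"
  shows "(L2_norm (box a b) f)\<^sup>2 = integral (cbox a b) (\<lambda>x. (f x)\<^sup>2)"
proof -
  have "L2_inner (box a b) f f = integral (cbox a b) (\<lambda>x. (f x)\<^sup>2)"
    unfolding L2_inner_def using assms
    by (subst set_integral_box_eq_integral) (auto intro!: continuous_intros simp: power2_eq_square)
  moreover have "0 \<le> integral (cbox a b) (\<lambda>x. (f x)\<^sup>2)"
    by (intro Henstock_Kurzweil_Integration.integral_nonneg integrable_continuous continuous_intros
        continuous_on_subset[OF assms]) auto
  ultimately show ?thesis by (simp add: L2_norm_def)
qed

text \<open>The common shape of \<open>A_fun\<close> and \<open>R_fun\<close>. It exhibits both as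
  integrals of pointwise expressions, so that an identity for real sequences can be applied at each
  x.\<close>

lemma sum_L2_norm_squares:
  fixes g :: "nat \<Rightarrow> 'a::euclidean_space \<Rightarrow> real"
  assumes g: "\<And>k. k \<in> K \<Longrightarrow> continuous_on UNIV (g k)" and h: "continuous_on UNIV h"
  shows "((\<lambda>x. 1/2 * (\<Sum>k\<in>K. c k * (g k x)\<^sup>2) + 1/2 * d * (h x)\<^sup>2) has_integral
    1/2 * (\<Sum>k\<in>K. c k * (L2_norm (box a b) (g k))\<^sup>2) + 1/2 * d * (L2_norm (box a b) h)\<^sup>2) (cbox a b)"
proof (cases "finite K")
  case True
  have *: "((\<lambda>x. (f x)\<^sup>2) has_integral (L2_norm (box a b) f)\<^sup>2) (cbox a b)"
    if "continuous_on UNIV f" for f :: "'a \<Rightarrow> real"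
    unfolding L2_norm_square[OF that]
    by (intro integrable_integral integrable_continuous continuous_intros continuous_on_subset[OF that]) auto
  show ?thesis
    using True by (intro has_integral_add has_integral_mult_right has_integral_sum * g h)
next
  \<comment> \<open>A sum over an infinite index set is 0 by convention, so only the last square
    remains.\<close>
  case False
  have "((\<lambda>x. (h x)\<^sup>2) has_integral (L2_norm (box a b) h)\<^sup>2) (cbox a b)"
    unfolding L2_norm_square[OF h]
    by (intro integrable_integral integrable_continuous continuous_intros continuous_on_subset[OF h]) auto
  from has_integral_mult_right[OF this, of "d / 2"] show ?thesis
    using False by simp
qed

lemma A_fun_R_fun_identity:
  fixes u :: "nat \<Rightarrow> 'a::euclidean_space \<Rightarrow> real"
  assumes m: "1 \<le> m" and u: "\<And>j. j \<in> {1..m + 1} \<Longrightarrow> continuous_on UNIV (u j)"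
  shows "A_fun (box a b) t \<beta> u (m + 1) - A_fun (box a b) t \<beta> u m + R_fun (box a b) t \<beta> u (m + 1)
    = integral (cbox a b) (\<lambda>x. (\<Sum>k=1..m+1. b_kernel t \<beta> (m + 1) (m + 1 - k) * u k x) * u (m + 1) x)"
proof -
  let ?B = "b_tilde t \<beta>"
  let ?A1 = "\<lambda>x. 1/2 * (\<Sum>k=1..m. (?B (m + 1) (m - k) - ?B (m + 1) (m + 1 - k)) * (\<Sum>j=k+1..m+1. u j x)\<^sup>2)
        + 1/2 * ?B (m + 1) m * (\<Sum>j=1..m+1. u j x)\<^sup>2"
  let ?A0 = "\<lambda>x. 1/2 * (\<Sum>k=1..m-1. (?B m (m - k - 1) - ?B m (m - k)) * (\<Sum>j=k+1..m. u j x)\<^sup>2)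
        + 1/2 * ?B m (m - 1) * (\<Sum>j=1..m. u j x)\<^sup>2"
  let ?R = "\<lambda>x. 1/2 * (\<Sum>k=1..m-1. (?B m (m - 1 - k) - ?B m (m - k) - ?B (m + 1) (m - k) + ?B (m + 1) (m + 1 - k))
            * (\<Sum>j=k+1..m. u j x)\<^sup>2)
        + 1/2 * (?B m (m - 1) - ?B (m + 1) m) * (\<Sum>j=1..m. u j x)\<^sup>2"
  have cont: "continuous_on UNIV (\<lambda>x. \<Sum>j=k..l. u j x)" if "1 \<le> k" "l \<le> m + 1" for k l
    using that by (intro continuous_on_sum u) auto
  have idx: "m + 1 - k - 1 = m - k" "m + 1 - 1 = m" "m + 1 - 2 = m - 1" "m - 1 - k = m - k - 1" for k
    using m by auto
  have A1: "(?A1 has_integral A_fun (box a b) t \<beta> u (m + 1)) (cbox a b)"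
    unfolding A_fun_def idx by (intro sum_L2_norm_squares cont) auto
  have A0: "(?A0 has_integral A_fun (box a b) t \<beta> u m) (cbox a b)"
    unfolding A_fun_def idx by (intro sum_L2_norm_squares cont) auto
  have R: "(?R has_integral R_fun (box a b) t \<beta> u (m + 1)) (cbox a b)"
    unfolding R_fun_def idx by (intro sum_L2_norm_squares cont) auto
  have "((\<lambda>x. ?A1 x - ?A0 x + ?R x) has_integral
      A_fun (box a b) t \<beta> u (m + 1) - A_fun (box a b) t \<beta> u m + R_fun (box a b) t \<beta> u (m + 1)) (cbox a b)"
    by (intro has_integral_add has_integral_diff A1 A0 R)
  moreover have "?A1 x - ?A0 x + ?R x
      = (\<Sum>k=1..m+1. b_kernel t \<beta> (m + 1) (m + 1 - k) * u k x) * u (m + 1) x" for x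
  proof -
    have "(\<Sum>k=1..m+1. b_kernel t \<beta> (m + 1) (m + 1 - k) * u k x)
        = ?B (m + 1) 0 / 2 * u (m + 1) x + (\<Sum>k=1..m. ?B (m + 1) (m + 1 - k) * u k x)"
      by (simp add: b_tilde_def)
    then show ?thesis
      using discrete_gradient_structure[OF m, of ?B "\<lambda>j. u j x"] by simp
  qed
  ultimately show ?thesis
    by (simp only: integral_unique)
qed

lemma R_fun_nonneg:
  assumes "\<And>k. 1 \<le> k \<Longrightarrow> k \<le> m \<Longrightarrow> 0 \<le> b_tilde t \<beta> (m + 1) (m - k) - b_tilde t \<beta> (m + 1) (m + 1 - k)
    - b_tilde t \<beta> (m + 2) (m + 1 - k) + b_tilde t \<beta> (m + 2) (m + 2 - k)"
    and "b_tilde t \<beta> (m + 2) (m + 1) \<le> b_tilde t \<beta> (m + 1) m"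
  shows "0 \<le> R_fun \<Omega> t \<beta> u (m + 2)"
proof -
  have idx: "m + 2 - 2 = m" "m + 2 - 1 = m + 1"
    by auto
  show ?thesis
    unfolding R_fun_def idx
  proof (rule add_nonneg_nonneg)
    show "0 \<le> 1/2 * (\<Sum>k=1..m. (b_tilde t \<beta> (m + 1) (m - k) - b_tilde t \<beta> (m + 1) (m + 1 - k)
        - b_tilde t \<beta> (m + 2) (m + 1 - k) + b_tilde t \<beta> (m + 2) (m + 2 - k))
        * (L2_norm \<Omega> (\<lambda>x. \<Sum>j=k+1..m+1. u j x))\<^sup>2)"
      by (intro mult_nonneg_nonneg sum_nonneg assms(1)) auto
  qed (use assms(2) in simp)
qed

lemma SH_op_half_avg:
  assumes "C_k 4 (\<phi> n)" "C_k 4 (\<phi> (n + 1))"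
  shows "SH_op (half_avg \<phi> n) x = (SH_op (\<phi> (n + 1)) x + SH_op (\<phi> n) x) / 2"
proof -
  have "half_avg \<phi> n = (\<lambda>x. 1/2 * \<phi> (n + 1) x + 1/2 * \<phi> n x)"
    by (simp add: half_avg_def fun_eq_iff)
  then show ?thesis
    using SH_op_lincomb[OF assms(2,1), of "1/2" "1/2"] by simp
qed

lemma relaxed_energy_step:
  fixes \<phi> r :: "nat \<Rightarrow> 'a::euclidean_space \<Rightarrow> real"
  assumes ab: "\<forall>i\<in>Basis. a \<bullet> i < b \<bullet> i" and M: "M > 0" and n: "n < N"
    and \<phi>: "\<forall>n\<le>N. box_periodic a b (\<phi> n) \<and> C_k 4 (\<phi> n)"
    and r: "\<forall>n\<le>N. continuous_on UNIV (r n)"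
    and scheme: "relaxation_scheme N t \<alpha> M g S c1 c2 \<phi> r \<mu>"
  shows "relaxed_energy (box a b) g S c1 c2 c3 (\<phi> (n + 1)) (r (n + 1))
      - relaxed_energy (box a b) g S c1 c2 c3 (\<phi> n) (r n)
    = - (1 / M) * integral (cbox a b) (\<lambda>x. L1plus t \<alpha> \<phi> n x * bdiff \<phi> (n + 1) x)"
proof -
  let ?u = "\<phi> (n + 1)" and ?v = "\<phi> n"
  let ?e = "\<lambda>w q x. 1/2 * w x * SH_op w x + 2 * (q x + S) * (1/2 * (w x)\<^sup>2 - g/3 * w x + c1 - S)
        - (q x)\<^sup>2 + c2 * w x"
  have u: "box_periodic a b ?u" "C_k 4 ?u" and v: "box_periodic a b ?v" "C_k 4 ?v"
    using \<phi> n by auto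
  have SHc: "continuous_on UNIV (SH_op w)" if "C_k 4 w" for w :: "'a \<Rightarrow> real"
    using SH_op_C_k[of 0 w] that C_k_continuous by auto
  note cont = C_k_continuous[OF u(2)] C_k_continuous[OF v(2)] SHc[OF u(2)] SHc[OF v(2)]
  have rc: "continuous_on UNIV (r n)" "continuous_on UNIV (r (n + 1))" using r n by auto
  have int: "f integrable_on cbox a b" if "continuous_on UNIV f" for f :: "'a \<Rightarrow> real"
    by (intro integrable_continuous continuous_on_subset[OF that]) auto
  have ec: "continuous_on UNIV (?e ?u (r (n + 1)))" "continuous_on UNIV (?e ?v (r n))"
    using cont rc by (auto intro!: continuous_intros)
  \<comment> \<open>Write r, r' for the old and new relaxation values, v, u for the old and new
    \<phi>, and P for the quadratic in the constraint. The increment of 2 (r + S) P - r^2 splits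
    into 2 (r' + S) (P(u) - P(v)), which comes from the chemical potential, and a rest that the
    constraint annihilates. The term left over with \<open>SH_op\<close> is antisymmetric in u and v
    and vanishes only after integration.\<close>
  have pt: "?e ?u (r (n + 1)) x - ?e ?v (r n) x = - (1 / M) * (L1plus t \<alpha> \<phi> n x * bdiff \<phi> (n + 1) x)
      + 1/2 * (?v x * SH_op ?u x - SH_op ?v x * ?u x)" for x
  proof -
    define P where "P y = 1/2 * y\<^sup>2 - g/3 * y + c1 - S" for y
    have eq: "L1plus t \<alpha> \<phi> n x = - M * \<mu> (n + 1) x"
      "\<mu> (n + 1) x = SH_op (half_avg \<phi> n) x + 2 * (r (n + 1) x + S) * (half_avg \<phi> n x - g/3) + c2"
      "r (n + 1) x + r n x = 2 * P (?v x)"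
      using scheme n by (auto simp: relaxation_scheme_def P_def field_simps)
    have L: "- (1 / M) * (L1plus t \<alpha> \<phi> n x * bdiff \<phi> (n + 1) x) = \<mu> (n + 1) x * (?u x - ?v x)"
      using M by (simp add: eq(1) bdiff_def)
    \<comment> \<open>Exact because P is quadratic: its derivative at the midpoint times the
      increment is the increment of P.\<close>
    have "2 * (r (n + 1) x + S) * (half_avg \<phi> n x - g/3) * (?u x - ?v x)
        = 2 * (r (n + 1) x + S) * (P (?u x) - P (?v x))"
      by (simp add: half_avg_def P_def power2_eq_square algebra_simps add_divide_distrib diff_divide_distrib)
    moreover have "(r n x)\<^sup>2 - (r (n + 1) x)\<^sup>2 + 2 * (r (n + 1) x - r n x) * P (?v x) = 0"
    proof -
      have "(r n x)\<^sup>2 - (r (n + 1) x)\<^sup>2 + (r (n + 1) x - r n x) * (r (n + 1) x + r n x) = 0"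
        by (simp add: power2_eq_square algebra_simps)
      then show ?thesis unfolding eq(3) by (simp only: mult_ac)
    qed
    moreover have "SH_op (half_avg \<phi> n) x * (?u x - ?v x) = 1/2 * ?u x * SH_op ?u x - 1/2 * ?v x * SH_op ?v x
        - 1/2 * (?v x * SH_op ?u x - SH_op ?v x * ?u x)"
      unfolding SH_op_half_avg[of \<phi>, OF v(2) u(2)] by (simp add: field_simps)
    ultimately show ?thesis
      unfolding L eq(2) distrib_right P_def[symmetric] by (simp add: algebra_simps)
  qed
  have Lc: "continuous_on UNIV (\<lambda>x. L1plus t \<alpha> \<phi> n x * bdiff \<phi> (n + 1) x)"
  proof -
    have "continuous_on UNIV (bdiff \<phi> k)" if "k \<le> n + 1" for k
      unfolding bdiff_def[abs_def] using \<phi> n that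
      by (intro continuous_on_diff C_k_continuous[of 4]) auto
    then show ?thesis
      unfolding L1plus_def by (intro continuous_intros) auto
  qed
  have "relaxed_energy (box a b) g S c1 c2 c3 ?u (r (n + 1)) - relaxed_energy (box a b) g S c1 c2 c3 ?v (r n)
      = integral (cbox a b) (?e ?u (r (n + 1))) - integral (cbox a b) (?e ?v (r n))"
    unfolding relaxed_energy_def by (simp only: set_integral_box_eq_integral[OF ec(1)]
        set_integral_box_eq_integral[OF ec(2)])
  also have "\<dots> = integral (cbox a b) (\<lambda>x. ?e ?u (r (n + 1)) x - ?e ?v (r n) x)"
    by (intro Henstock_Kurzweil_Integration.integral_diff[symmetric] int ec)
  also have "\<dots> = integral (cbox a b) (\<lambda>x. - (1 / M) * (L1plus t \<alpha> \<phi> n x * bdiff \<phi> (n + 1) x))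
      + integral (cbox a b) (\<lambda>x. 1/2 * (?v x * SH_op ?u x - SH_op ?v x * ?u x))"
    unfolding pt
    by (intro Henstock_Kurzweil_Integration.integral_add int continuous_on_mult[OF continuous_on_const Lc])
      (intro continuous_on_mult continuous_on_diff continuous_on_const cont)
  also have "integral (cbox a b) (\<lambda>x. 1/2 * (?v x * SH_op ?u x - SH_op ?v x * ?u x))
      = 1/2 * (integral (cbox a b) (\<lambda>x. ?v x * SH_op ?u x) - integral (cbox a b) (\<lambda>x. SH_op ?v x * ?u x))"
    using cont by (simp only: integral_mult_right)
      (subst Henstock_Kurzweil_Integration.integral_diff, auto intro!: int continuous_on_mult)
  also have "\<dots> = 0"
    using SH_op_symmetric[OF ab v(1) u(1) v(2) u(2)] by simp
  finally show ?thesis by (simp only: integral_mult_right add_0_right)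
qed

text \<open>Completing the square: with q + S = u^2/2 - g u/3 + c1, the terms other than the
  operator term are (q + S)^2 - S^2 + c2 u. Matching the quartic density makes c1 fix the
  coefficient of u^2, c2 = 2 g c1 / 3 cancel the linear term, and c3 = - c1^2 remove the
  constant.\<close>

lemma relaxed_energy_initial:
  fixes u q :: "'a::euclidean_space \<Rightarrow> real"
  assumes "c1 = \<delta>/2 - g\<^sup>2/9" "c2 = g * \<delta> / 3 - 2 * g^3 / 27" "c3 = - ((\<delta>/2 - g\<^sup>2/9)\<^sup>2)"
    and q: "\<forall>x. q x = 1/2 * (u x)\<^sup>2 - g/3 * u x + c1 - S" and u: "C_k 4 u"
  shows "relaxed_energy (box a b) g S c1 c2 c3 u q = SH_energy (box a b) g \<delta> u"
proof -
  let ?e = "\<lambda>x. 1/2 * u x * SH_op u x + 2 * (q x + S) * (1/2 * (u x)\<^sup>2 - g/3 * u x + c1 - S)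
        - (q x)\<^sup>2 + c2 * u x"
  let ?f = "\<lambda>x. 1/2 * u x * SH_op u x + 1/4 * (u x)^4 - g/3 * (u x)^3 + \<delta>/2 * (u x)^2"
  have pt: "?e x = ?f x - (c3 + S\<^sup>2)" for x
    unfolding q[rule_format] assms(1-3)
    by (simp add: power2_eq_square power3_eq_cube power4_eq_xxxx algebra_simps add_divide_distrib diff_divide_distrib)
  have "continuous_on UNIV (SH_op u)"
    using SH_op_C_k[of 0 u] u C_k_continuous by auto
  then have "continuous_on UNIV ?f"
    using C_k_continuous[OF u] by (intro continuous_intros)
  then have int: "set_integrable lebesgue (box a b) ?f"
    by (rule continuous_on_set_integrable_box)
  have "set_integrable lebesgue (box a b) (\<lambda>x. c3 + S\<^sup>2)"
    by (intro continuous_on_set_integrable_box continuous_on_const)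
  then have "(LINT x:box a b|lebesgue. ?e x) = (LINT x:box a b|lebesgue. ?f x) - (LINT x:box a b|lebesgue. c3 + S\<^sup>2)"
    unfolding pt using int by (intro set_integral_diff)
  then show ?thesis
    unfolding relaxed_energy_def SH_energy_def by (simp add: set_lebesgue_integral_def mult.commute)
qed

theorem theorem3p4:
  fixes a b :: "'a::euclidean_space"
    and \<Omega> :: "'a set"
    and \<alpha> M g \<delta> S c1 c2 c3 T :: real
    and N :: nat
    and t :: "nat \<Rightarrow> real"
    and \<phi> r \<mu> :: "nat \<Rightarrow> 'a \<Rightarrow> real"
  assumes "\<forall>i\<in>Basis. a \<bullet> i < b \<bullet> i"
    and "\<Omega> = box a b"
    and "0 < \<alpha>" "\<alpha> < 1" "M > 0"
    and "c1 = \<delta>/2 - g\<^sup>2/9"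
    and "c2 = g * \<delta> / 3 - 2 * g^3 / 27"
    and "c3 = - ((\<delta>/2 - g\<^sup>2/9)\<^sup>2)"
    and "N \<ge> 1" "t 0 = 0" "\<forall>k\<in>{1..N}. t (k - 1) < t k" "t N = T"
    and "\<forall>n\<le>N. box_periodic a b (\<phi> n) \<and> C_k 4 (\<phi> n)"
    and "\<forall>n\<le>N. box_periodic a b (r n) \<and> continuous_on UNIV (r n)"
    and "\<forall>n\<in>{1..N}. box_periodic a b (\<mu> n) \<and> continuous_on UNIV (\<mu> n)"
    and "relaxation_scheme N t \<alpha> M g S c1 c2 \<phi> r \<mu>"
  shows "((\<forall>n<N. relaxed_energy \<Omega> g S c1 c2 c3 (\<phi> (n + 1)) (r (n + 1))
                   \<le> relaxed_energy \<Omega> g S c1 c2 c3 (\<phi> 0) (r 0))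
            \<and> relaxed_energy \<Omega> g S c1 c2 c3 (\<phi> 0) (r 0) = SH_energy \<Omega> g \<delta> (\<phi> 0))
       \<and> ((\<forall>k. 2 \<le> k \<and> k + 1 \<le> N \<longrightarrow>
              step_ratio t (k + 1) \<ge> H_fun (1 - \<alpha>) (step_ratio t k)) \<longrightarrow>
          (\<forall>n. 2 \<le> n \<and> n \<le> N - 1 \<longrightarrow>
              variational_energy \<Omega> t \<alpha> M g S c1 c2 c3 \<phi> r (n + 1)
                - variational_energy \<Omega> t \<alpha> M g S c1 c2 c3 \<phi> r n
                = - (1 / M) * R_fun \<Omega> t (1 - \<alpha>) (bdiff \<phi>) (n + 1)
            \<and> - (1 / M) * R_fun \<Omega> t (1 - \<alpha>) (bdiff \<phi>) (n + 1) \<le> 0))"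
proof -
  note \<Omega> = assms(2) and M = assms(5) and t = assms(11) and \<phi> = assms(13) and scheme = assms(16)
  have \<beta>: "0 < 1 - \<alpha>" "1 - \<alpha> < 1" using assms by auto
  let ?E = "\<lambda>n. relaxed_energy \<Omega> g S c1 c2 c3 (\<phi> n) (r n)"
  let ?D = "\<lambda>n x. L1plus t \<alpha> \<phi> n x * bdiff \<phi> (n + 1) x"
  have bc: "continuous_on UNIV (bdiff \<phi> k)" if "k \<le> N" for k
    unfolding bdiff_def[abs_def] using \<phi> that
    by (intro continuous_on_diff C_k_continuous[of 4]) auto
  have step: "?E (n + 1) - ?E n = - (1 / M) * integral (cbox a b) (?D n)" if "n < N" for n
    unfolding \<Omega> using relaxed_energy_step[OF assms(1) M that \<phi> _ scheme] assms(14) by blast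
  have int: "?D n integrable_on cbox a b" if "n < N" for n
  proof -
    have "continuous_on UNIV (?D n)"
      unfolding L1plus_def using that
      by (intro continuous_on_mult continuous_on_sum continuous_on_const bc) auto
    then show ?thesis
      by (intro integrable_continuous) (rule continuous_on_subset, auto)
  qed
  have i: "?E (n + 1) \<le> ?E 0" if n: "n < N" for n
  proof -
    have "?E (n + 1) - ?E 0 = (\<Sum>m<n+1. ?E (Suc m) - ?E m)"
      by (rule sum_lessThan_telescope[symmetric])
    also have "\<dots> = (\<Sum>m<n+1. - (1 / M) * integral (cbox a b) (?D m))"
      using step n by (intro sum.cong refl) auto
    also have "\<dots> = - (1 / M) * integral (cbox a b) (\<lambda>x. \<Sum>m<n+1. ?D m x)"
      unfolding sum_distrib_left[symmetric] using int n
      by (subst Henstock_Kurzweil_Integration.integral_sum) auto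
    finally have eq: "?E (n + 1) - ?E 0 = - (1 / M) * integral (cbox a b) (\<lambda>x. \<Sum>m<n+1. ?D m x)" .
    \<comment> \<open>Nonnegative at every x, although a single summand may have either sign: the
      history has to be summed from the first level on.\<close>
    have "0 \<le> (\<Sum>m<n+1. ?D m x)" for x
    proof -
      have "(\<Sum>m<n+1. ?D m x) = (\<Sum>m\<in>{1..n+1}. (\<Sum>k=1..m. b_kernel t (1 - \<alpha>) m (m - k) * bdiff \<phi> k x) * bdiff \<phi> m x)"
        by (rule sum.reindex_bij_witness[of _ "\<lambda>m. m - 1" Suc]) (auto simp: L1plus_def)
      also have "\<dots> \<ge> 0"
        using L1plus_kernel_pos_semidef[OF \<beta> t, of "n + 1"] n by simp
      finally show ?thesis .
    qed
    then have "0 \<le> integral (cbox a b) (\<lambda>x. \<Sum>m<n+1. ?D m x)"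
      using int n by (intro Henstock_Kurzweil_Integration.integral_nonneg integrable_sum) auto
    then have "- (1 / M) * integral (cbox a b) (\<lambda>x. \<Sum>m<n+1. ?D m x) \<le> 0"
      using M by simp
    then show ?thesis using eq by linarith
  qed
  have init: "?E 0 = SH_energy \<Omega> g \<delta> (\<phi> 0)"
    unfolding \<Omega> using scheme \<phi>
    by (intro relaxed_energy_initial[OF assms(6-8)]) (auto simp: relaxation_scheme_def)
  have ii: "variational_energy \<Omega> t \<alpha> M g S c1 c2 c3 \<phi> r (n + 1) - variational_energy \<Omega> t \<alpha> M g S c1 c2 c3 \<phi> r n
      = - (1 / M) * R_fun \<Omega> t (1 - \<alpha>) (bdiff \<phi>) (n + 1)"
    if n: "1 \<le> n" "n < N" for n
  proof -
    have "A_fun \<Omega> t (1 - \<alpha>) (bdiff \<phi>) (n + 1) - A_fun \<Omega> t (1 - \<alpha>) (bdiff \<phi>) n + R_fun \<Omega> t (1 - \<alpha>) (bdiff \<phi>) (n + 1)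
        = integral (cbox a b) (?D n)"
      unfolding \<Omega> L1plus_def using n by (intro A_fun_R_fun_identity bc) auto
    with step[OF n(2)] have "?E (n + 1) - ?E n = - (1 / M) * (A_fun \<Omega> t (1 - \<alpha>) (bdiff \<phi>) (n + 1)
        - A_fun \<Omega> t (1 - \<alpha>) (bdiff \<phi>) n + R_fun \<Omega> t (1 - \<alpha>) (bdiff \<phi>) (n + 1))"
      by simp
    then show ?thesis
      by (simp add: variational_energy_def diff_divide_distrib add_divide_distrib)
  qed
  have R: "0 \<le> R_fun \<Omega> t (1 - \<alpha>) (bdiff \<phi>) (n + 1)"
    if H: "\<forall>k. 2 \<le> k \<and> k + 1 \<le> N \<longrightarrow> step_ratio t (k + 1) \<ge> H_fun (1 - \<alpha>) (step_ratio t k)"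
      and n: "2 \<le> n" "n \<le> N - 1" for n
  proof -
    \<comment> \<open>Only the cells n - 1, n and n + 1 meet in the diagonal coefficient, so the
      condition is used at k = n, which is admissible because 2 \<le> n.\<close>
    obtain m where m: "n = m + 1" "1 \<le> m" "m + 2 \<le> N"
      using n by (cases n) auto
    have "H_fun (1 - \<alpha>) (step_ratio t (m + 1)) \<le> step_ratio t (m + 2)"
      using H[rule_format, of "m + 1"] m by simp
    then have "0 \<le> R_fun \<Omega> t (1 - \<alpha>) (bdiff \<phi>) (m + 2)"
      using m by (intro R_fun_nonneg b_tilde_mixed_diff_nonneg[OF \<beta> t] b_tilde_first_antimono[OF \<beta> t])
    then show ?thesis by (simp add: m)
  qed
  have "- (1 / M) * y \<le> 0" if "0 \<le> y" for y :: real
    using that M by simp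
  with i init ii R show ?thesis
    by auto
qed

end
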